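(* Let $(\eta,\overline{\boldsymbol u})$ be a sufficiently regular spatially periodic solution on the periodic cell $S_H$ of any one of the three location-uncertainty (LU) wave models (LU Saint-Venant, LU Boussinesq, LU Serre-Green-Naghdi) defined in the context, and assume that the depth-averaged horizontal noise vanishes on $\partial S_H$. Let $\rho_0>0$ be the constant density. Then, pathwise, the horizontal integral of the surface elevation and the total mass are conserved: $$\mathrm d_t\Big(\int_{S_H}\eta\,\mathrm dS_H\Big)=0,\qquad \mathrm d_t m=0,\quad\text{where } m=\rho_0\int_{S_H}h\,\mathrm dS_H,\ h=1+\epsilon\eta .$$
   Context: Let $d\in\{1,2\}$ and let $S_H\subset\mathbb R^d$ be a bounded interval ($d=1$) or rectangle ($d=2$), regarded as a periodic cell: all fields below and their spatial derivatives satisfy periodic boundary conditions on $\partial S_H$. $\nabla_H$ and $\nabla_H\cdot$ are the gradient and divergence in the horizontal variables. The parameters $\epsilon,\beta,\Upsilon>0$ are constants. All quantities are nondimensional. Work on a filtered probability space carrying independent standard one-dimensional Brownian motions $(\beta^n)_n$. The unknowns are the surface elevation $\eta(\boldsymbol x,t)\in\mathbb R$ and the depth-averaged horizontal velocity $\overline{\boldsymbol u}(\boldsymbol x,t)\in\mathbb R^d$; the water depth is $h=1+\epsilon\eta$, assumed positive. The depth-averaged Itô-Stokes drift $\overline{\boldsymbol u}_s(\boldsymbol x,t)\in\mathbb R^d$ is a periodic field. The depth-averaged horizontal noise is $\overline{\boldsymbol\sigma\circ\mathrm d\boldsymbol B_t^H}=\sum_n\boldsymbol\varphi_n(\boldsymbol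 x,t)\circ\mathrm d\beta^n_t$ with $\mathbb R^d$-valued spatially periodic fields $\boldsymbol\varphi_n$ (Stratonovich sense). "The noise vanishes on $\partial S_H$" means that every $\boldsymbol\varphi_n$ vanishes there. Set $\overline{\boldsymbol u}^*=\overline{\boldsymbol u}-\tfrac12\Upsilon\epsilon\,\overline{\boldsymbol u}_s$. All stochastic differentials and products of processes with stochastic differentials are in the Stratonovich sense, $\mathrm d_t$ denotes the time differential at fixed $\boldsymbol x$ (or of a space-independent process), and for a scalar or vector field $f$ $$\overline D^H_t f=\mathrm d_t f+\epsilon(\overline{\boldsymbol u}^*\cdot\nabla_H)f\,\mathrm dt+\Upsilon^{1/2}\epsilon\,(\overline{\boldsymbol\sigma\circ\mathrm d\boldsymbol B_t^H}\cdot\nabla_H)f .$$ The three models are the systems $$\overline D^H_t\eta=-h\big(\nabla_H\cdot\overline{\boldsymbol u}^*\,\mathrm dt+\Upsilon^{1/2}\nabla_H\cdot\overline{\boldsymbol\sigma\circ\mathrm d\boldsymbol B_t^H}\big),$$ $$\overline D^H_t\overline{\boldsymbol u}+\nabla_H\eta\,\mathrm dt-\frac1h\,\epsilon\beta^2\,\nabla_H\Big(\frac{h^3}{3}\,\mathrm d\overline G\Big)=0,$$ with, respectively: - LU Saint-Venant: $\mathrm d\overline G=0$; - LU Boussinesq: $\mathrm d\overline G=\mathrm d_t(\nabla_H\cdot\overline{\boldsymbol u})$; - LU Serre-Green-Naghdi: $\mathrm d\overline G=\overline D^H_t(\nabla_H\cdot\overline{\boldsymbol u})-\epsilon\,\nabla_H\cdot\big(\overline{\boldsymbol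 u}^*\,\mathrm dt+\Upsilon^{1/2}\overline{\boldsymbol\sigma\circ\mathrm d\boldsymbol B_t^H}\big)\,\nabla_H\cdot\overline{\boldsymbol u}$. "Sufficiently regular" means: $\eta,\overline{\boldsymbol u}$ are continuous semimartingales in time with values in spatially smooth periodic fields, the coefficients $\overline{\boldsymbol u}_s,\boldsymbol\varphi_n$ are smooth in space and are such that all sums and Stratonovich integrals converge, and the Stratonovich product rule, spatial differentiation and integration over $S_H$ may be applied to and interchanged with the stochastic differentials. *)

theory Defs
  imports "HOL-Probability.Probability"
begin

section \<open>Smooth periodic fields\<close>

definition pdv :: "'a::euclidean_space \<Rightarrow> ('a \<Rightarrow> 'b::real_normed_vector) \<Rightarrow> 'a \<Rightarrow> 'b" where
  "pdv i f x = frechet_derivative f (at x) i"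

primrec pdvs :: "'a::euclidean_space list \<Rightarrow> ('a \<Rightarrow> 'b::real_normed_vector) \<Rightarrow> 'a \<Rightarrow> 'b" where
  "pdvs [] f = f"
| "pdvs (i # is) f = pdv i (pdvs is f)"

definition grad :: "('a::euclidean_space \<Rightarrow> real) \<Rightarrow> 'a \<Rightarrow> 'a" where
  "grad f x = (\<Sum>i\<in>Basis. pdv i f x *\<^sub>R i)"

definition diverg :: "('a::euclidean_space \<Rightarrow> 'a) \<Rightarrow> 'a \<Rightarrow> real" where
  "diverg v x = (\<Sum>i\<in>Basis. pdv i (\<lambda>y. v y \<bullet> i) x)"

definition smooth :: "('a::euclidean_space \<Rightarrow> 'b::real_normed_vector) \<Rightarrow> bool" where
  "smooth f \<longleftrightarrow> (\<forall>is\<in>lists Basis. \<forall>x. pdvs is f differentiable (at x))"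

text \<open>A field on the periodic cell \<open>cbox a b\<close> is represented by its periodic extension to
  the whole space; smoothness of the extension says that the field and all its derivatives satisfy
  the periodic boundary conditions.\<close>

definition periodic :: "'a::euclidean_space \<Rightarrow> 'a \<Rightarrow> ('a \<Rightarrow> 'b) \<Rightarrow> bool" where
  "periodic a b f \<longleftrightarrow> (\<forall>x. \<forall>i\<in>Basis. f (x + ((b - a) \<bullet> i) *\<^sub>R i) = f x)"

definition smooth_periodic ::
  "'a::euclidean_space \<Rightarrow> 'a \<Rightarrow> ('a \<Rightarrow> 'b::real_normed_vector) \<Rightarrow> bool" where
  "smooth_periodic a b f \<longleftrightarrow> smooth f \<and> periodic a b f"


section \<open>Processes on the time interval from 0 to T\<close>

definition adapted :: "(real \<Rightarrow> 'w measure) \<Rightarrow> real \<Rightarrow>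
    ('w \<Rightarrow> real \<Rightarrow> 'b::topological_space) \<Rightarrow> bool" where
  "adapted F T X \<longleftrightarrow> (\<forall>t\<in>{0..T}. (\<lambda>\<omega>. X \<omega> t) \<in> borel_measurable (F t))"

definition martingale_on ::
  "'w measure \<Rightarrow> (real \<Rightarrow> 'w measure) \<Rightarrow> real \<Rightarrow> ('w \<Rightarrow> real \<Rightarrow> real) \<Rightarrow> bool" where
  "martingale_on M F T X \<longleftrightarrow>
     adapted F T X \<and>
     (\<forall>t\<in>{0..T}. integrable M (\<lambda>\<omega>. X \<omega> t)) \<and>
     (\<forall>s\<in>{0..T}. \<forall>t\<in>{s..T}. AE \<omega> in M. real_cond_exp M (F s) (\<lambda>\<omega>. X \<omega> t) \<omega> = X \<omega> s)"

definition cont_local_martingale ::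
  "'w measure \<Rightarrow> (real \<Rightarrow> 'w measure) \<Rightarrow> real \<Rightarrow> ('w \<Rightarrow> real \<Rightarrow> real) \<Rightarrow> bool" where
  "cont_local_martingale M F T X \<longleftrightarrow>
     adapted F T X \<and>
     (AE \<omega> in M. continuous_on {0..T} (X \<omega>)) \<and>
     (\<exists>\<tau> :: nat \<Rightarrow> 'w \<Rightarrow> real.
        (\<forall>k. stopping_time F (\<tau> k)) \<and>
        (\<forall>k. \<forall>\<omega>\<in>space M. 0 \<le> \<tau> k \<omega> \<and> \<tau> k \<omega> \<le> \<tau> (Suc k) \<omega>) \<and>
        (AE \<omega> in M. \<exists>k. T \<le> \<tau> k \<omega>) \<and>
        (\<forall>k. martingale_on M F T (\<lambda>\<omega> t. X \<omega> (min t (\<tau> k \<omega>)) - X \<omega> 0)))"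

definition partition_on_to :: "real \<Rightarrow> nat \<Rightarrow> (nat \<Rightarrow> real) \<Rightarrow> bool" where
  "partition_on_to t N p \<longleftrightarrow> p 0 = 0 \<and> p N = t \<and> (\<forall>k<N. p k \<le> p (Suc k))"

definition cont_finite_variation ::
  "'w measure \<Rightarrow> (real \<Rightarrow> 'w measure) \<Rightarrow> real \<Rightarrow> ('w \<Rightarrow> real \<Rightarrow> real) \<Rightarrow> bool" where
  "cont_finite_variation M F T X \<longleftrightarrow>
     adapted F T X \<and>
     (AE \<omega> in M. continuous_on {0..T} (X \<omega>)) \<and>
     (AE \<omega> in M. \<exists>C. \<forall>N p. partition_on_to T N p \<longrightarrow>
        (\<Sum>k<N. \<bar>X \<omega> (p (Suc k)) - X \<omega> (p k)\<bar>) \<le> C)"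

definition brownian_motion ::
  "'w measure \<Rightarrow> (real \<Rightarrow> 'w measure) \<Rightarrow> ('w \<Rightarrow> real \<Rightarrow> real) \<Rightarrow> bool" where
  "brownian_motion M F W \<longleftrightarrow>
     (\<forall>t\<ge>0. (\<lambda>\<omega>. W \<omega> t) \<in> borel_measurable (F t)) \<and>
     (AE \<omega> in M. W \<omega> 0 = 0) \<and>
     (AE \<omega> in M. continuous_on {0..} (W \<omega>)) \<and>
     (\<forall>s t. 0 \<le> s \<and> s < t \<longrightarrow>
        distributed M lborel (\<lambda>\<omega>. W \<omega> t - W \<omega> s) (normal_density 0 (sqrt (t - s))) \<and>
        prob_space.indep_set M (sets (F s))
          (sets (vimage_algebra (space M) (\<lambda>\<omega>. W \<omega> t - W \<omega> s) borel)))"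


section \<open>Field-valued processes\<close>

type_synonym ('w, 'a, 'b) field = "'w \<Rightarrow> real \<Rightarrow> 'a \<Rightarrow> 'b"

text \<open>Almost surely a continuous path in the space of smooth periodic functions (with the
  topology of uniform convergence of all derivatives).\<close>

definition cont_smooth_field :: "'w measure \<Rightarrow> real \<Rightarrow> 'a \<Rightarrow> 'a \<Rightarrow>
    ('w, 'a::euclidean_space, 'b::real_normed_vector) field \<Rightarrow> bool" where
  "cont_smooth_field M T a b f \<longleftrightarrow>
     (AE \<omega> in M.
        (\<forall>t\<in>{0..T}. smooth_periodic a b (f \<omega> t)) \<and>
        (\<forall>is\<in>lists Basis. continuous_on ({0..T} \<times> UNIV) (\<lambda>(t, x). pdvs is (f \<omega> t) x)))"

text \<open>Continuous semimartingales with values in smooth periodic functions, in the sense of Kunita.\<close>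

definition smooth_semimartingale :: "'w measure \<Rightarrow> (real \<Rightarrow> 'w measure) \<Rightarrow> real \<Rightarrow> 'a \<Rightarrow> 'a \<Rightarrow>
    ('w, 'a::euclidean_space, real) field \<Rightarrow> bool" where
  "smooth_semimartingale M F T a b f \<longleftrightarrow>
     (\<exists>m v. (\<forall>\<omega>\<in>space M. \<forall>t\<in>{0..T}. \<forall>x. f \<omega> t x = m \<omega> t x + v \<omega> t x) \<and>
        cont_smooth_field M T a b m \<and> cont_smooth_field M T a b v \<and>
        (\<forall>is\<in>lists Basis. \<forall>x.
           cont_local_martingale M F T (\<lambda>\<omega> t. pdvs is (m \<omega> t) x) \<and>
           cont_finite_variation M F T (\<lambda>\<omega> t. pdvs is (v \<omega> t) x)))"

text \<open>Smooth periodic fields which, together with each of their derivatives, are integrable in time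
  uniformly in space: their time integrals converge as integrals of smooth fields.\<close>

definition time_integrable_field :: "'w measure \<Rightarrow> real \<Rightarrow> 'a \<Rightarrow> 'a \<Rightarrow>
    ('w, 'a::euclidean_space, 'b::euclidean_space) field \<Rightarrow> bool" where
  "time_integrable_field M T a b f \<longleftrightarrow>
     (AE \<omega> in M.
        (\<forall>t\<in>{0..T}. smooth_periodic a b (f \<omega> t)) \<and>
        (\<forall>is\<in>lists Basis.
           (\<lambda>(t, x). pdvs is (f \<omega> t) x) \<in> borel_measurable (restrict_space borel ({0..T} \<times> UNIV)) \<and>
           (\<exists>g. set_integrable lborel {0..T} g \<and>
             (\<forall>t\<in>{0..T}. \<forall>x. norm (pdvs is (f \<omega> t) x) \<le> g t))))"


section \<open>Stratonovich integrals of fields\<close>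

text \<open>Stratonovich integrals are limits in probability of trapezoidal sums, where convergence of
  fields is uniform convergence on the cell of every derivative. Hence the integral commutes with
  spatial differentiation and with integration over the cell; the product rule is exact for
  trapezoidal sums. A stochastic differential is represented by its integral from time 0.\<close>

definition strat_sum :: "nat \<Rightarrow> (nat \<Rightarrow> real) \<Rightarrow> (real \<Rightarrow> real) \<Rightarrow> (real \<Rightarrow> real) \<Rightarrow> real" where
  "strat_sum N p Y X = (\<Sum>k<N. (Y (p k) + Y (p (Suc k))) / 2 * (X (p (Suc k)) - X (p k)))"

lemma strat_sum_product_rule:
  assumes "partition_on_to t N p"
  shows "strat_sum N p Y X + strat_sum N p X Y = Y t * X t - Y 0 * X 0"
proof -
  have "strat_sum N p Y X + strat_sum N p X Y
      = (\<Sum>k<N. Y (p (Suc k)) * X (p (Suc k)) - Y (p k) * X (p k))"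
    unfolding strat_sum_def sum.distrib[symmetric]
    by (rule sum.cong) (auto simp: field_simps)
  also have "\<dots> = Y (p N) * X (p N) - Y (p 0) * X (p 0)"
    by (rule sum_lessThan_telescope)
  finally show ?thesis
    using assms by (simp add: partition_on_to_def)
qed

text \<open>The exceptional event is required to lie in a measurable set of small probability, so that no
  measurability of the supremum over \<open>x\<close> is presupposed.\<close>

definition close_in_prob :: "'w measure \<Rightarrow> 'a \<Rightarrow> 'a \<Rightarrow> 'a list \<Rightarrow> real \<Rightarrow>
    ('w \<Rightarrow> 'a::euclidean_space \<Rightarrow> real) \<Rightarrow> ('w \<Rightarrow> 'a \<Rightarrow> real) \<Rightarrow> bool" where
  "close_in_prob M a b is e f g \<longleftrightarrow>
     (\<exists>A\<in>sets M. measure M A < e \<and>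
        (\<forall>\<omega>\<in>space M - A. \<forall>x\<in>cbox a b. \<bar>pdvs is (f \<omega>) x - pdvs is (g \<omega>) x\<bar> < e))"

definition has_strat_integral :: "'w measure \<Rightarrow> real \<Rightarrow> 'a \<Rightarrow> 'a \<Rightarrow>
    ('w, 'a::euclidean_space, real) field \<Rightarrow> ('w, 'a, real) field \<Rightarrow> ('w, 'a, real) field \<Rightarrow> bool" where
  "has_strat_integral M T a b Y X J \<longleftrightarrow>
     cont_smooth_field M T a b J \<and>
     (\<forall>t\<in>{0..T}. \<forall>is\<in>lists Basis. \<forall>e>0. \<exists>\<delta>>0. \<forall>N p.
        partition_on_to t N p \<and> (\<forall>k<N. p (Suc k) - p k < \<delta>) \<longrightarrow>
        close_in_prob M a b is e
          (\<lambda>\<omega> x. strat_sum N p (\<lambda>s. Y \<omega> s x) (\<lambda>s. X \<omega> s x)) (\<lambda>\<omega>. J \<omega> t))"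

text \<open>\<open>J\<close> is the integral of the differential which is the sum over \<open>n \<in> I\<close> of
  \<open>Y n \<circ> dB n\<close>.\<close>

definition has_noise_integral :: "'w measure \<Rightarrow> real \<Rightarrow> 'a \<Rightarrow> 'a \<Rightarrow> nat set \<Rightarrow>
    (nat \<Rightarrow> 'w \<Rightarrow> real \<Rightarrow> real) \<Rightarrow> (nat \<Rightarrow> ('w, 'a::euclidean_space, real) field) \<Rightarrow>
    ('w, 'a, real) field \<Rightarrow> bool" where
  "has_noise_integral M T a b I B Y J \<longleftrightarrow>
     cont_smooth_field M T a b J \<and>
     (\<exists>K. (\<forall>n\<in>I. has_strat_integral M T a b (Y n) (\<lambda>\<omega> t x. B n \<omega> t) (K n)) \<and>
        (\<forall>t\<in>{0..T}. \<forall>is\<in>lists Basis. \<forall>e>0. \<exists>N0. \<forall>N\<ge>N0.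
           close_in_prob M a b is e
             (\<lambda>\<omega> x. \<Sum>n | n \<in> I \<and> n < N. K n \<omega> t x) (\<lambda>\<omega>. J \<omega> t)))"


section \<open>The wave models\<close>

datatype lu_model = Saint_Venant | Boussinesq | Serre_Green_Naghdi

text \<open>The periodic cell is \<open>cbox a b\<close>. The noise is the sum of \<open>\<phi> n \<circ> dB n\<close> over \<open>n \<in> I\<close>; \<open>us\<close>
  is the depth-averaged Ito-Stokes drift.\<close>

locale lu_waves = prob_space M for M :: "'w measure" +
  fixes F :: "real \<Rightarrow> 'w measure"
    and T :: real
    and a b :: "'a::euclidean_space"
    and \<epsilon> \<beta> \<Upsilon> :: real
    and I :: "nat set"
    and B :: "nat \<Rightarrow> 'w \<Rightarrow> real \<Rightarrow> real"
    and us :: "('w, 'a, 'a) field"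
    and \<phi> :: "nat \<Rightarrow> ('w, 'a, 'a) field"
  assumes filtration: "filtration (space M) F"
    and subalgebra: "\<And>t. subalgebra M (F t)"
    and time_horizon: "0 < T"
    and dimension: "DIM('a) \<in> {1, 2}"
    and cell: "box a b \<noteq> {}"
    and parameters: "0 < \<epsilon>" "0 < \<beta>" "0 < \<Upsilon>"
    and brownian: "\<And>n. n \<in> I \<Longrightarrow> brownian_motion M F (B n)"
    and brownian_indep:
      "indep_vars (\<lambda>n. PiM {0..} (\<lambda>t. borel)) (\<lambda>n \<omega>. \<lambda>t\<in>{0..}. B n \<omega> t) I"
    and drift_adapted: "\<And>x. adapted F T (\<lambda>\<omega> t. us \<omega> t x)"
    and drift_regular: "time_integrable_field M T a b us"
    and noise_adapted: "\<And>n x. n \<in> I \<Longrightarrow> adapted F T (\<lambda>\<omega> t. \<phi> n \<omega> t x)"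
    and noise_smooth:
      "\<And>n. n \<in> I \<Longrightarrow> AE \<omega> in M. \<forall>t\<in>{0..T}. smooth_periodic a b (\<phi> n \<omega> t)"
    and noise_converges:
      "\<And>i. i \<in> Basis \<Longrightarrow> \<exists>J. has_noise_integral M T a b I B (\<lambda>n \<omega> t x. \<phi> n \<omega> t x \<bullet> i) J"
begin

definition noise_vanishes_on_boundary :: bool where
  "noise_vanishes_on_boundary \<longleftrightarrow>
     (\<forall>n\<in>I. AE \<omega> in M. \<forall>t\<in>{0..T}. \<forall>x\<in>frontier (cbox a b). \<phi> n \<omega> t x = 0)"

definition depth :: "('w, 'a, real) field \<Rightarrow> ('w, 'a, real) field" where
  "depth \<eta> \<omega> t x = 1 + \<epsilon> * \<eta> \<omega> t x"

definition ustar :: "('w, 'a, 'a) field \<Rightarrow> ('w, 'a, 'a) field" where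
  "ustar u \<omega> t x = u \<omega> t x - (1 / 2 * \<Upsilon> * \<epsilon>) *\<^sub>R us \<omega> t x"

text \<open>\<open>Z\<close> is the integral from time 0 of the stochastic material derivative of the scalar field
  \<open>f\<close>. For vector fields the operator acts on the components.\<close>

definition has_material :: "('w, 'a, 'a) field \<Rightarrow> ('w, 'a, real) field \<Rightarrow>
    ('w, 'a, real) field \<Rightarrow> bool" where
  "has_material u f Z \<longleftrightarrow>
     (\<exists>J. has_noise_integral M T a b I B (\<lambda>n \<omega> t x. \<phi> n \<omega> t x \<bullet> grad (f \<omega> t) x) J \<and>
        (AE \<omega> in M. \<forall>t\<in>{0..T}. \<forall>x.
           Z \<omega> t x = f \<omega> t x - f \<omega> 0 x
             + \<epsilon> * integral {0..t} (\<lambda>s. ustar u \<omega> s x \<bullet> grad (f \<omega> s) x)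
             + sqrt \<Upsilon> * \<epsilon> * J \<omega> t x))"

text \<open>\<open>D\<close> is the integral of \<open>f (div ustar dt + sqrt \<Upsilon> div (noise))\<close>, where the Stratonovich
  product of \<open>f\<close> with the series of noise differentials is taken term by term.\<close>

definition has_div_transport :: "('w, 'a, 'a) field \<Rightarrow> ('w, 'a, real) field \<Rightarrow>
    ('w, 'a, real) field \<Rightarrow> bool" where
  "has_div_transport u f D \<longleftrightarrow>
     (\<exists>J. has_noise_integral M T a b I B (\<lambda>n \<omega> t x. f \<omega> t x * diverg (\<phi> n \<omega> t) x) J \<and>
        (AE \<omega> in M. \<forall>t\<in>{0..T}. \<forall>x.
           D \<omega> t x = integral {0..t} (\<lambda>s. f \<omega> s x * diverg (ustar u \<omega> s) x)
             + sqrt \<Upsilon> * J \<omega> t x))"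

definition mass_equation :: "('w, 'a, real) field \<Rightarrow> ('w, 'a, 'a) field \<Rightarrow> bool" where
  "mass_equation \<eta> u \<longleftrightarrow>
     (\<exists>Z D. has_material u \<eta> Z \<and> has_div_transport u (depth \<eta>) D \<and>
        (AE \<omega> in M. \<forall>t\<in>{0..T}. \<forall>x\<in>cbox a b. Z \<omega> t x = - D \<omega> t x))"

text \<open>\<open>G\<close> is the integral from time 0 of the model-dependent differential in the dispersive term.\<close>

definition has_dispersion :: "lu_model \<Rightarrow> ('w, 'a, 'a) field \<Rightarrow> ('w, 'a, real) field \<Rightarrow> bool" where
  "has_dispersion model u G \<longleftrightarrow>
     (case model of
        Saint_Venant \<Rightarrow> (AE \<omega> in M. \<forall>t\<in>{0..T}. \<forall>x. G \<omega> t x = 0)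
      | Boussinesq \<Rightarrow>
          (AE \<omega> in M. \<forall>t\<in>{0..T}. \<forall>x. G \<omega> t x = diverg (u \<omega> t) x - diverg (u \<omega> 0) x)
      | Serre_Green_Naghdi \<Rightarrow>
          (\<exists>Z D. has_material u (\<lambda>\<omega> t. diverg (u \<omega> t)) Z \<and>
             has_div_transport u (\<lambda>\<omega> t. diverg (u \<omega> t)) D \<and>
             (AE \<omega> in M. \<forall>t\<in>{0..T}. \<forall>x. G \<omega> t x = Z \<omega> t x - \<epsilon> * D \<omega> t x)))"

text \<open>\<open>K\<close> is the integral of \<open>(h^3 / 3) \<circ> dG\<close> and \<open>P\<close> that of \<open>(1 / h) \<circ> d(pdv i K)\<close>.\<close>

definition momentum_equation ::
  "lu_model \<Rightarrow> ('w, 'a, real) field \<Rightarrow> ('w, 'a, 'a) field \<Rightarrow> bool" where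
  "momentum_equation model \<eta> u \<longleftrightarrow>
     (\<exists>G K. has_dispersion model u G \<and>
        has_strat_integral M T a b (\<lambda>\<omega> t x. depth \<eta> \<omega> t x ^ 3 / 3) G K \<and>
        (\<forall>i\<in>Basis. \<exists>Z P. has_material u (\<lambda>\<omega> t x. u \<omega> t x \<bullet> i) Z \<and>
           has_strat_integral M T a b (\<lambda>\<omega> t x. 1 / depth \<eta> \<omega> t x) (\<lambda>\<omega> t. pdv i (K \<omega> t)) P \<and>
           (AE \<omega> in M. \<forall>t\<in>{0..T}. \<forall>x\<in>cbox a b.
              Z \<omega> t x + integral {0..t} (\<lambda>s. pdv i (\<eta> \<omega> s) x)
                - \<epsilon> * \<beta>\<^sup>2 * P \<omega> t x = 0)))"

definition regular_solution ::
  "lu_model \<Rightarrow> ('w, 'a, real) field \<Rightarrow> ('w, 'a, 'a) field \<Rightarrow> bool" where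
  "regular_solution model \<eta> u \<longleftrightarrow>
     smooth_semimartingale M F T a b \<eta> \<and>
     (\<forall>i\<in>Basis. smooth_semimartingale M F T a b (\<lambda>\<omega> t x. u \<omega> t x \<bullet> i)) \<and>
     (AE \<omega> in M. \<forall>t\<in>{0..T}. \<forall>x. 0 < depth \<eta> \<omega> t x) \<and>
     mass_equation \<eta> u \<and> momentum_equation model \<eta> u"

definition total_elevation :: "('w, 'a, real) field \<Rightarrow> 'w \<Rightarrow> real \<Rightarrow> real" where
  "total_elevation \<eta> \<omega> t = integral (cbox a b) (\<eta> \<omega> t)"

definition total_mass :: "real \<Rightarrow> ('w, 'a, real) field \<Rightarrow> 'w \<Rightarrow> real \<Rightarrow> real" where
  "total_mass \<rho> \<eta> \<omega> t = \<rho> * integral (cbox a b) (depth \<eta> \<omega> t)"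

end

text \<open>The time differential of a space-independent process vanishes pathwise.\<close>

definition zero_differential :: "'w measure \<Rightarrow> real \<Rightarrow> ('w \<Rightarrow> real \<Rightarrow> real) \<Rightarrow> bool" where
  "zero_differential M T X \<longleftrightarrow> (AE \<omega> in M. \<forall>s\<in>{0..T}. \<forall>t\<in>{s..T}. X \<omega> t - X \<omega> s = 0)"

end

theory Submission
  imports Defs
begin

text \<open>With \<open>h = 1 + \<epsilon> \<eta>\<close>, the mass equation is a conservation law: as \<open>\<epsilon> grad \<eta> = grad h\<close>, the
  advection of the elevation and the divergence term combine into the divergence of the flux
  \<open>h ustar\<close> in the drift part and of \<open>h \<phi> n\<close> in the noise part. The divergence of a smooth periodic
  field has integral zero over the cell (lemma \<open>integral_depth_flux_periodic\<close>), so the integral of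
  \<open>\<eta>\<close> over the cell does not change; the mass is an affine function of that integral. The
  three models share this mass equation.

  What remains is to exchange the integral over the cell with the integrals in time. For the drift
  part this is Fubini's theorem, path by path (lemma \<open>time_dominated_Fubini\<close>). The noise part is a
  series of limits in probability of trapezoidal sums, uniformly on the cell. The trapezoidal sums
  have integral zero over the cell because the fluxes have this property at each time; so do
  the limits at each fixed time (lemma \<open>integral_zero_limit_in_prob\<close>), and by continuity
  almost surely at all times (lemma \<open>noise_integral_zero_mean\<close>).\<close>

section \<open>Derivatives of fields\<close>

lemma pdv_eq: "(f has_derivative f') (at x) \<Longrightarrow> pdv i f x = f' i"
  unfolding pdv_def by (metis frechet_derivative_at)

lemma pdv_add:
  "f differentiable (at x) \<Longrightarrow> g differentiable (at x) \<Longrightarrow>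
    pdv i (\<lambda>y. f y + g y) x = pdv i f x + pdv i g x"
  by (rule pdv_eq[OF has_derivative_add, THEN trans])
     (auto simp: frechet_derivative_works[symmetric] pdv_def)

lemma pdv_bounded_linear:
  assumes "bounded_linear L" and "f differentiable (at x)"
  shows "pdv i (\<lambda>y. L (f y)) x = L (pdv i f x)"
  by (rule pdv_eq[OF bounded_linear.has_derivative[OF assms(1)], THEN trans])
     (auto simp: frechet_derivative_works[symmetric] pdv_def assms)

lemma pdv_mult:
  fixes f g :: "'a::euclidean_space \<Rightarrow> real"
  shows "f differentiable (at x) \<Longrightarrow> g differentiable (at x) \<Longrightarrow>
    pdv i (\<lambda>y. f y * g y) x = f x * pdv i g x + pdv i f x * g x"
  by (rule pdv_eq[OF has_derivative_mult, THEN trans])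
     (auto simp: frechet_derivative_works[symmetric] pdv_def)

lemma pdvs_add:
  assumes "smooth f" "smooth g" "is \<in> lists Basis"
  shows "pdvs is (\<lambda>x. f x + g x) = (\<lambda>x. pdvs is f x + pdvs is g x)"
  using assms(3)
proof (induction "is")
  case (Cons i "is")
  then have "pdvs is (\<lambda>x. f x + g x) = (\<lambda>x. pdvs is f x + pdvs is g x)" "is \<in> lists Basis"
    by auto
  then show ?case
    using assms(1,2) by (auto intro!: ext pdv_add simp: smooth_def)
qed simp

lemma smooth_add: "smooth f \<Longrightarrow> smooth g \<Longrightarrow> smooth (\<lambda>x. f x + g x)"
  by (subst smooth_def) (auto simp: pdvs_add smooth_def)

lemma pdvs_bounded_linear:
  assumes "bounded_linear L" "smooth f" "is \<in> lists Basis"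
  shows "pdvs is (\<lambda>x. L (f x)) = (\<lambda>x. L (pdvs is f x))"
  using assms(3)
proof (induction "is")
  case (Cons i "is")
  then have "pdvs is (\<lambda>x. L (f x)) = (\<lambda>x. L (pdvs is f x))" "is \<in> lists Basis"
    by auto
  then show ?case
    using assms(2) by (auto intro!: ext pdv_bounded_linear[OF assms(1)] simp: smooth_def)
qed simp

lemma smooth_bounded_linear: "bounded_linear L \<Longrightarrow> smooth f \<Longrightarrow> smooth (\<lambda>x. L (f x))"
  by (subst smooth_def)
     (auto simp: pdvs_bounded_linear smooth_def
       intro!: differentiable_compose[where f = L, OF bounded_linear_imp_differentiable])

lemma pdv_affine: "f differentiable (at x) \<Longrightarrow> pdv i (\<lambda>y. k + c * f y) x = (c :: real) * pdv i f x"
  by (rule pdv_eq[OF has_derivative_add[OF has_derivative_const has_derivative_mult_right], THEN trans])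
     (auto simp: frechet_derivative_works[symmetric] pdv_def)

lemma smooth_affine:
  fixes f :: "'a::euclidean_space \<Rightarrow> real"
  assumes "smooth f"
  shows "smooth (\<lambda>x. k + c * f x)"
proof -
  have const: "\<exists>d. pdvs is (\<lambda>x :: 'a. k) = (\<lambda>x. d)" for "is"
  proof (induction "is")
    case (Cons i "is")
    then obtain d where "pdvs is (\<lambda>x :: 'a. k) = (\<lambda>x. d)"
      by blast
    then show ?case
      by (intro exI[of _ 0] ext) (simp add: pdv_eq[OF has_derivative_const])
  qed auto
  have "smooth (\<lambda>x :: 'a. k)"
    unfolding smooth_def
  proof (intro ballI allI)
    fix "is" and x :: 'a
    obtain d where "pdvs is (\<lambda>x :: 'a. k) = (\<lambda>x. d)"
      using const by blast
    then show "pdvs is (\<lambda>x :: 'a. k) differentiable at x"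
      by simp
  qed
  then show ?thesis
    by (intro smooth_add smooth_bounded_linear[OF bounded_linear_mult_right assms])
qed

lemma smooth_periodic_add:
  "smooth_periodic a b f \<Longrightarrow> smooth_periodic a b g \<Longrightarrow> smooth_periodic a b (\<lambda>x. f x + g x)"
  by (auto simp: smooth_periodic_def smooth_add periodic_def)

lemma smooth_periodic_bounded_linear:
  "bounded_linear L \<Longrightarrow> smooth_periodic a b f \<Longrightarrow> smooth_periodic a b (\<lambda>x. L (f x))"
  by (auto simp: smooth_periodic_def smooth_bounded_linear periodic_def)

lemma smooth_differentiable: "smooth f \<Longrightarrow> f differentiable (at x)"
  unfolding smooth_def by (metis lists.Nil pdvs.simps(1))

lemma smooth_pdv_differentiable: "smooth f \<Longrightarrow> i \<in> Basis \<Longrightarrow> pdv i f differentiable (at x)"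
  unfolding smooth_def by (metis lists.Cons lists.Nil pdvs.simps)

lemma smooth_continuous: "smooth f \<Longrightarrow> continuous_on S f"
  by (meson continuous_at_imp_continuous_on differentiable_imp_continuous_within smooth_differentiable)

lemma smooth_pdv_continuous: "smooth f \<Longrightarrow> i \<in> Basis \<Longrightarrow> continuous_on S (pdv i f)"
  by (meson continuous_at_imp_continuous_on differentiable_imp_continuous_within smooth_pdv_differentiable)

section \<open>Integrals of periodic fields over the cell\<close>

lemma integral_translate:
  fixes f :: "'a::euclidean_space \<Rightarrow> real"
  assumes "continuous_on UNIV f"
  shows "integral (cbox a b) (\<lambda>x. f (x + c)) = integral (cbox (a + c) (b + c)) f"
proof -
  have "f integrable_on cbox (a + c) (b + c)"
    using assms by (intro integrable_continuous) (auto intro: continuous_on_subset)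
  then have "(f has_integral integral (cbox (a + c) (b + c)) f) (cbox (a + c) (b + c))"
    by (rule integrable_integral)
  from has_integral_affinity[OF this, of 1 c]
  have "((\<lambda>x. f (x + c)) has_integral integral (cbox (a + c) (b + c)) f)
      ((\<lambda>x. x - c) ` cbox (a + c) (b + c))"
    by simp
  moreover have "(\<lambda>x. x - c) ` cbox (a + c) (b + c) = cbox a b"
    using cbox_translation[of "-c" "a + c" "b + c"] by simp
  ultimately show ?thesis
    by (simp add: integral_unique)
qed

text \<open>Both the cell and its translate by \<open>s\<close> in the direction \<open>k\<close> lie in
  \<open>cbox a (b + s *\<^sub>R k)\<close>; the two slabs left over are translates of each other by one period.\<close>

lemma integral_periodic_shift:
  fixes f :: "'a::euclidean_space \<Rightarrow> real"
  assumes cont: "continuous_on UNIV f" and per: "periodic a b f"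
    and k: "k \<in> Basis" and s: "0 \<le> s" "s \<le> (b - a) \<bullet> k"
  shows "integral (cbox a b) (\<lambda>x. f (x + s *\<^sub>R k)) = integral (cbox a b) f"
proof -
  define L where "L = (b - a) \<bullet> k"
  let ?C = "cbox a (b + s *\<^sub>R k)"
  have int: "f integrable_on cbox c d" for c d
    using cont by (intro integrable_continuous) (auto intro: continuous_on_subset)
  have mem: "x \<in> cbox c d \<longleftrightarrow> c \<bullet> k \<le> x \<bullet> k \<and> x \<bullet> k \<le> d \<bullet> k \<and>
      (\<forall>i\<in>Basis - {k}. c \<bullet> i \<le> x \<bullet> i \<and> x \<bullet> i \<le> d \<bullet> i)" for x c d :: 'a
    using k by (auto simp: mem_box)
  have [simp]: "k \<bullet> i = 0" if "i \<in> Basis - {k}" for i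
    using that k by (auto simp: inner_Basis)
  note [simp] = inner_add_left inner_diff_left inner_scaleR_left k
  have s': "0 \<le> s" "s \<le> L" using s by (auto simp: L_def)
  have L: "b \<bullet> k = a \<bullet> k + L" by (simp add: L_def)
  have eq: "?C \<inter> {x. x \<bullet> k \<le> b \<bullet> k} = cbox a b"
    "?C \<inter> {x. x \<bullet> k \<ge> b \<bullet> k} = cbox (a + L *\<^sub>R k) (b + (s - L) *\<^sub>R k + L *\<^sub>R k)"
    "?C \<inter> {x. x \<bullet> k \<le> a \<bullet> k + s} = cbox a (b + (s - L) *\<^sub>R k)"
    "?C \<inter> {x. x \<bullet> k \<ge> a \<bullet> k + s} = cbox (a + s *\<^sub>R k) (b + s *\<^sub>R k)"
    using s' L by (auto simp: mem)
  have "f (x + L *\<^sub>R k) = f x" for x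
    using per by (simp add: periodic_def L_def)
  then have "integral (?C \<inter> {x. x \<bullet> k \<ge> b \<bullet> k}) f = integral (?C \<inter> {x. x \<bullet> k \<le> a \<bullet> k + s}) f"
    unfolding eq using integral_translate[OF cont, of a "b + (s - L) *\<^sub>R k" "L *\<^sub>R k"] by simp
  moreover have "integral ?C f = integral (cbox a b) f + integral (?C \<inter> {x. x \<bullet> k \<ge> b \<bullet> k}) f"
    using integral_split[OF int k, of a "b + s *\<^sub>R k" "b \<bullet> k"] by (simp only: eq)
  moreover have "integral ?C f = integral (?C \<inter> {x. x \<bullet> k \<le> a \<bullet> k + s}) f
      + integral (cbox (a + s *\<^sub>R k) (b + s *\<^sub>R k)) f"
    using integral_split[OF int k, of a "b + s *\<^sub>R k" "a \<bullet> k + s"] by (simp only: eq)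
  ultimately show ?thesis
    using integral_translate[OF cont, of a b "s *\<^sub>R k"] by simp
qed

lemma periodic_pdv:
  fixes f :: "'a::euclidean_space \<Rightarrow> 'b::real_normed_vector"
  assumes "periodic a b f" and diff: "\<And>x. f differentiable (at x)"
  shows "periodic a b (pdv i f)"
  unfolding periodic_def
proof (intro allI ballI)
  fix x and j :: 'a assume j: "j \<in> Basis"
  let ?c = "((b - a) \<bullet> j) *\<^sub>R j"
  have "(f has_derivative frechet_derivative f (at (x + ?c))) (at (x + ?c))"
    using diff frechet_derivative_works by blast
  then have "((\<lambda>y. f (y + ?c)) has_derivative frechet_derivative f (at (x + ?c))) (at x)"
    by (rule has_derivative_compose[of "\<lambda>y. y + ?c" "\<lambda>h. h", rotated])
       (auto intro!: derivative_eq_intros)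
  moreover have "(\<lambda>y. f (y + ?c)) = f"
    using assms(1) j by (auto simp: periodic_def)
  ultimately show "pdv i f (x + ?c) = pdv i f x"
    using pdv_eq[of f _ x i] by (simp add: pdv_def)
qed

text \<open>The average over a full period of the integrals of \<open>pdv i f\<close> over the translated cells vanishes by
  the fundamental theorem of calculus on each line in the direction \<open>i\<close>, while all these integrals
  agree.\<close>

lemma integral_pdv_periodic:
  fixes f :: "'a::euclidean_space \<Rightarrow> real"
  assumes per: "periodic a b f" and diff: "\<And>x. f differentiable (at x)"
    and cont: "continuous_on UNIV (pdv i f)" and i: "i \<in> Basis" and cell: "box a b \<noteq> {}"
  shows "integral (cbox a b) (pdv i f) = 0"
proof -
  define L where "L = (b - a) \<bullet> i"
  have L: "0 < L"
    using cell i by (auto simp: L_def box_ne_empty inner_diff_left)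
  have inner: "integral {0..L} (\<lambda>s. pdv i f (x + s *\<^sub>R i)) = 0" for x
  proof -
    have "((\<lambda>s. f (x + s *\<^sub>R i)) has_vector_derivative pdv i f (x + s *\<^sub>R i)) (at s within {0..L})" for s
    proof -
      have f: "(f has_derivative frechet_derivative f (at (x + s *\<^sub>R i))) (at (x + s *\<^sub>R i))"
        using diff frechet_derivative_works by blast
      have "((\<lambda>s. x + s *\<^sub>R i) has_derivative (\<lambda>h. h *\<^sub>R i)) (at s)"
        by (auto intro!: derivative_eq_intros)
      from has_derivative_compose[OF this f]
      have "((\<lambda>s. f (x + s *\<^sub>R i)) has_derivative
          (\<lambda>h. frechet_derivative f (at (x + s *\<^sub>R i)) (h *\<^sub>R i))) (at s)" .
      then have "((\<lambda>s. f (x + s *\<^sub>R i)) has_vector_derivative pdv i f (x + s *\<^sub>R i)) (at s)"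
        using linear_scale[OF has_derivative_linear[OF f]]
        by (simp add: has_vector_derivative_def pdv_def)
      then show ?thesis by (rule has_vector_derivative_at_within)
    qed
    then have "((\<lambda>s. pdv i f (x + s *\<^sub>R i)) has_integral f (x + L *\<^sub>R i) - f (x + 0 *\<^sub>R i)) {0..L}"
      using L by (intro fundamental_theorem_of_calculus) auto
    then show ?thesis
      using per i by (simp add: integral_unique periodic_def L_def)
  qed
  have "continuous_on (cbox (0, a) (L, b)) (\<lambda>(s, x). pdv i f (x + s *\<^sub>R i))"
    unfolding case_prod_unfold
    by (intro continuous_on_compose2[OF cont] continuous_intros) auto
  from integral_swap_continuous[OF this]
  have "integral {0..L} (\<lambda>s. integral (cbox a b) (\<lambda>x. pdv i f (x + s *\<^sub>R i))) = 0"
    by (simp add: inner)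
  moreover have "integral {0..L} (\<lambda>s. integral (cbox a b) (\<lambda>x. pdv i f (x + s *\<^sub>R i)))
      = integral {0..L} (\<lambda>s. integral (cbox a b) (pdv i f))"
    by (intro integral_cong integral_periodic_shift cont periodic_pdv per diff i) (auto simp: L_def)
  ultimately show ?thesis
    using L by simp
qed

lemma inner_grad: "v \<bullet> grad h x = (\<Sum>i\<in>Basis. (v \<bullet> i) * pdv i h x)"
  by (simp add: grad_def inner_sum_right mult.commute)

lemma continuous_on_advection:
  assumes "smooth h" "\<And>i. i \<in> Basis \<Longrightarrow> smooth (\<lambda>x. v x \<bullet> i)"
  shows "continuous_on S (\<lambda>x. v x \<bullet> grad h x)"
  unfolding inner_grad
  by (intro continuous_intros smooth_continuous smooth_pdv_continuous assms)

lemma continuous_on_diverg: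
  assumes "\<And>i. i \<in> Basis \<Longrightarrow> smooth (\<lambda>x. v x \<bullet> i)"
  shows "continuous_on S (diverg v)"
  unfolding diverg_def
  by (intro continuous_intros smooth_pdv_continuous assms)

text \<open>The integrand is the divergence of \<open>h v\<close>, written out by the product rule.\<close>

lemma integral_flux_periodic:
  fixes a b :: "'a::euclidean_space"
  assumes h: "smooth_periodic a b h"
    and v: "\<And>i. i \<in> Basis \<Longrightarrow> smooth_periodic a b (\<lambda>x. v x \<bullet> i)"
    and cell: "box a b \<noteq> {}"
  shows "integral (cbox a b) (\<lambda>x. v x \<bullet> grad h x + h x * diverg v x) = 0"
proof -
  have h': "smooth h" and v': "\<And>i. i \<in> Basis \<Longrightarrow> smooth (\<lambda>x. v x \<bullet> i)"
    using h v by (auto simp: smooth_periodic_def)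
  have pdv: "pdv i (\<lambda>x. h x * (v x \<bullet> i)) = (\<lambda>x. h x * pdv i (\<lambda>x. v x \<bullet> i) x + pdv i h x * (v x \<bullet> i))"
    if "i \<in> Basis" for i
    using that by (auto intro!: pdv_mult smooth_differentiable h' v')
  have cont: "continuous_on UNIV (pdv i (\<lambda>x. h x * (v x \<bullet> i)))" if "i \<in> Basis" for i
    unfolding pdv[OF that] using that
    by (intro continuous_intros smooth_continuous smooth_pdv_continuous h' v')
  have "v x \<bullet> grad h x + h x * diverg v x = (\<Sum>i\<in>Basis. pdv i (\<lambda>x. h x * (v x \<bullet> i)) x)" for x
    by (simp add: pdv inner_grad diverg_def sum_distrib_left sum.distrib mult.commute add.commute)
  then have "integral (cbox a b) (\<lambda>x. v x \<bullet> grad h x + h x * diverg v x)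
      = (\<Sum>i\<in>Basis. integral (cbox a b) (pdv i (\<lambda>x. h x * (v x \<bullet> i))))"
    using cont by (subst integral_sum[symmetric])
      (auto intro!: integrable_continuous intro: continuous_on_subset)
  also have "\<dots> = 0"
  proof (intro sum.neutral ballI integral_pdv_periodic)
    fix i :: 'a assume i: "i \<in> Basis"
    show "periodic a b (\<lambda>x. h x * (v x \<bullet> i))"
      using h v[OF i] by (simp add: smooth_periodic_def periodic_def)
    show "(\<lambda>x. h x * (v x \<bullet> i)) differentiable (at x)" for x
      using i by (intro differentiable_mult smooth_differentiable h' v')
  qed (use cont cell in auto)
  finally show ?thesis .
qed

text \<open>The flux identity for the depth \<open>1 + \<epsilon> \<eta>\<close>, whose gradient is \<open>\<epsilon>\<close> times that of \<open>\<eta>\<close>. It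
  serves both for the velocity and for each noise coefficient.\<close>

lemma integral_depth_flux_periodic:
  fixes \<eta> :: "'a::euclidean_space \<Rightarrow> real"
  assumes \<eta>: "smooth_periodic a b \<eta>"
    and v: "\<And>i. i \<in> Basis \<Longrightarrow> smooth_periodic a b (\<lambda>x. v x \<bullet> i)"
    and cell: "box a b \<noteq> {}"
  shows "integral (cbox a b) (\<lambda>x. \<epsilon> * (v x \<bullet> grad \<eta> x) + (1 + \<epsilon> * \<eta> x) * diverg v x) = 0"
proof -
  let ?h = "\<lambda>x. 1 + \<epsilon> * \<eta> x"
  have "smooth_periodic a b ?h"
    using \<eta> smooth_affine by (auto simp: smooth_periodic_def periodic_def)
  moreover have "v x \<bullet> grad ?h x = \<epsilon> * (v x \<bullet> grad \<eta> x)" for x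
    using \<eta> by (simp add: inner_grad sum_distrib_left pdv_affine smooth_differentiable
        smooth_periodic_def mult_ac)
  ultimately show ?thesis
    using integral_flux_periodic[of a b ?h v] v cell by simp
qed

section \<open>Time integrals of fields\<close>

text \<open>A real field on the time interval which is jointly measurable and bounded on the cell by an
  integrable function of time alone: the hypotheses of Fubini's theorem, in a form that is stable
  under sums and under multiplication by jointly continuous fields.\<close>

definition time_dominated :: "real \<Rightarrow> 'a \<Rightarrow> 'a \<Rightarrow> (real \<Rightarrow> 'a::euclidean_space \<Rightarrow> real) \<Rightarrow> bool" where
  "time_dominated T a b G \<longleftrightarrow>
     (\<lambda>(t, x). G t x) \<in> borel_measurable (restrict_space borel ({0..T} \<times> UNIV)) \<and>
     (\<exists>g. set_integrable lborel {0..T} g \<and> (\<forall>t\<in>{0..T}. \<forall>x\<in>cbox a b. \<bar>G t x\<bar> \<le> g t))"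

lemma continuous_on_time_bounded:
  fixes G :: "real \<Rightarrow> 'a::euclidean_space \<Rightarrow> real"
  assumes "continuous_on ({0..T} \<times> UNIV) (\<lambda>(t, x). G t x)"
  obtains C where "0 \<le> C" "\<And>t x. t \<in> {0..T} \<Longrightarrow> x \<in> cbox a b \<Longrightarrow> \<bar>G t x\<bar> \<le> C"
proof -
  have "compact ((\<lambda>(t, x). G t x) ` ({0..T} \<times> cbox a b))"
    by (intro compact_continuous_image compact_Times continuous_on_subset[OF assms]) auto
  then have "bounded ((\<lambda>(t, x). G t x) ` ({0..T} \<times> cbox a b))"
    by (rule compact_imp_bounded)
  then obtain C where "\<And>y. y \<in> (\<lambda>(t, x). G t x) ` ({0..T} \<times> cbox a b) \<Longrightarrow> \<bar>y\<bar> \<le> C"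
    unfolding bounded_iff real_norm_def by blast
  then have "\<bar>G t x\<bar> \<le> max C 0" if "t \<in> {0..T}" "x \<in> cbox a b" for t x
    using that by (fastforce simp: le_max_iff_disj)
  then show thesis
    by (intro that[of "max C 0"]) auto
qed

lemma time_dominated_continuous:
  assumes "continuous_on ({0..T} \<times> UNIV) (\<lambda>(t, x). G t x)"
  shows "time_dominated T a b G"
proof -
  obtain C where "\<And>t x. t \<in> {0..T} \<Longrightarrow> x \<in> cbox a b \<Longrightarrow> \<bar>G t x\<bar> \<le> C"
    using continuous_on_time_bounded[OF assms] by metis
  moreover have "set_integrable lborel {0..T} (\<lambda>_. C)"
    unfolding set_integrable_def by (intro borel_integrable_compact) auto
  ultimately show ?thesis
    using borel_measurable_continuous_on_restrict[OF assms] by (auto simp: time_dominated_def)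
qed

lemma time_dominated_add:
  assumes "time_dominated T a b G" "time_dominated T a b H"
  shows "time_dominated T a b (\<lambda>t x. G t x + H t x)"
proof -
  obtain g h where *: "set_integrable lborel {0..T} g" "set_integrable lborel {0..T} h"
    "\<And>t x. t \<in> {0..T} \<Longrightarrow> x \<in> cbox a b \<Longrightarrow> \<bar>G t x\<bar> \<le> g t \<and> \<bar>H t x\<bar> \<le> h t"
    using assms unfolding time_dominated_def by metis
  then have "\<forall>t\<in>{0..T}. \<forall>x\<in>cbox a b. \<bar>G t x + H t x\<bar> \<le> g t + h t"
    by (meson abs_triangle_ineq add_mono order_trans)
  moreover have "set_integrable lborel {0..T} (\<lambda>t. g t + h t)"
    using * by (intro set_integral_add)
  ultimately show ?thesis
    using assms unfolding time_dominated_def case_prod_unfold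
    by (intro conjI exI[of _ "\<lambda>t. g t + h t"] borel_measurable_add) auto
qed

lemma time_dominated_mult:
  assumes cont: "continuous_on ({0..T} \<times> UNIV) (\<lambda>(t, x). G t x)" and H: "time_dominated T a b H"
  shows "time_dominated T a b (\<lambda>t x. G t x * H t x)"
proof -
  obtain C where C: "0 \<le> C" "\<And>t x. t \<in> {0..T} \<Longrightarrow> x \<in> cbox a b \<Longrightarrow> \<bar>G t x\<bar> \<le> C"
    using continuous_on_time_bounded[OF cont] by metis
  obtain h where h: "set_integrable lborel {0..T} h"
    "\<And>t x. t \<in> {0..T} \<Longrightarrow> x \<in> cbox a b \<Longrightarrow> \<bar>H t x\<bar> \<le> h t"
    using H unfolding time_dominated_def by metis
  have "\<forall>t\<in>{0..T}. \<forall>x\<in>cbox a b. \<bar>G t x * H t x\<bar> \<le> C * h t"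
    using C h(2) by (auto simp: abs_mult intro!: mult_mono)
  moreover have "set_integrable lborel {0..T} (\<lambda>t. C * h t)"
    using h by simp
  ultimately show ?thesis
    using H borel_measurable_continuous_on_restrict[OF cont]
    unfolding time_dominated_def case_prod_unfold
    by (intro conjI exI[of _ "\<lambda>t. C * h t"] borel_measurable_times) auto
qed

lemma time_dominated_sum:
  assumes "finite S" "\<And>i. i \<in> S \<Longrightarrow> time_dominated T a b (G i)"
  shows "time_dominated T a b (\<lambda>t x. \<Sum>i\<in>S. G i t x)"
  using assms
proof (induction S)
  case empty
  show ?case
    by (simp add: time_dominated_continuous case_prod_unfold)
next
  case (insert i S)
  then show ?case
    using time_dominated_add[of T a b "G i" "\<lambda>t x. \<Sum>i\<in>S. G i t x"] by simp
qed

lemma time_dominated_cong: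
  assumes "\<And>t x. t \<in> {0..T} \<Longrightarrow> G t x = H t x"
  shows "time_dominated T a b G \<longleftrightarrow> time_dominated T a b H"
proof -
  have "(\<lambda>(t, x). G t x) \<in> borel_measurable (restrict_space borel ({0..T} \<times> UNIV))
      \<longleftrightarrow> (\<lambda>(t, x). H t x) \<in> borel_measurable (restrict_space borel ({0..T} \<times> UNIV))"
    using assms by (intro measurable_cong) (auto simp: space_restrict_space)
  then show ?thesis
    using assms by (auto simp: time_dominated_def)
qed

text \<open>The integrals here are gauge integrals, so integrability has to be carried along with the
  exchange of the order of integration.\<close>

lemma time_dominated_Fubini:
  fixes G :: "real \<Rightarrow> 'a::euclidean_space \<Rightarrow> real"
  assumes dom: "time_dominated T a b G" and t: "t \<in> {0..T}"
  shows "\<And>x. x \<in> cbox a b \<Longrightarrow> (\<lambda>s. G s x) integrable_on {0..t}"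
    and "(\<lambda>x. integral {0..t} (\<lambda>s. G s x)) integrable_on cbox a b"
    and "integral (cbox a b) (\<lambda>x. integral {0..t} (\<lambda>s. G s x))
      = integral {0..t} (\<lambda>s. integral (cbox a b) (G s))"
proof -
  obtain g where g: "set_integrable lborel {0..T} g"
    "\<And>s x. s \<in> {0..T} \<Longrightarrow> x \<in> cbox a b \<Longrightarrow> \<bar>G s x\<bar> \<le> g s"
    using dom unfolding time_dominated_def by metis
  have g': "set_integrable lborel {0..t} g"
    using g(1) t by (elim set_integrable_subset) auto
  \<comment> \<open>The restriction to the compact box extended by zero, to which the Lebesgue theory applies.\<close>
  define H where "H = (\<lambda>(s, x). indicator ({0..t} \<times> cbox a b) (s, x) * G s x)"
  have "{0..T} \<times> (UNIV :: 'a set) \<in> sets borel"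
    by (intro borel_Times) auto
  then have "(\<lambda>z. indicator ({0..T} \<times> UNIV) z *\<^sub>R (case z of (s, x) \<Rightarrow> G s x)) \<in> borel_measurable borel"
    using dom unfolding time_dominated_def by (subst (asm) borel_measurable_restrict_space_iff) auto
  moreover have "indicator ({0..t} \<times> cbox a b) \<in> borel_measurable (borel :: (real \<times> 'a) measure)"
    by (intro borel_measurable_indicator borel_Times) auto
  ultimately have "(\<lambda>z. indicator ({0..t} \<times> cbox a b) z *
      (indicator ({0..T} \<times> UNIV) z *\<^sub>R (case z of (s, x) \<Rightarrow> G s x)) :: real) \<in> borel_measurable borel"
    by (intro borel_measurable_times)
  also have "(\<lambda>z. indicator ({0..t} \<times> cbox a b) z *
      (indicator ({0..T} \<times> UNIV) z *\<^sub>R (case z of (s, x) \<Rightarrow> G s x)) :: real) = H"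
    using t by (auto simp: H_def indicator_def fun_eq_iff)
  finally have "H \<in> borel_measurable borel" .
  then have H [measurable]: "H \<in> borel_measurable (lborel \<Otimes>\<^sub>M lborel)"
    by (simp add: lborel_prod)
  have bound: "\<bar>H (s, x)\<bar> \<le> indicator {0..t} s * g s * indicator (cbox a b) x" for s x
    using g(2) t by (auto simp: H_def indicator_def)
  have cell: "integrable lborel (indicator (cbox a b) :: 'a \<Rightarrow> real)"
    using borel_integrable_compact[of "cbox a b" "\<lambda>_. 1 :: real"] by simp
  have sec1: "integrable lborel (\<lambda>s. H (s, x))" for x
  proof (rule Bochner_Integration.integrable_bound)
    show "integrable lborel (\<lambda>s. indicator {0..t} s * g s * indicator (cbox a b) x)"
      using g' by (intro integrable_mult_left) (simp add: set_integrable_def)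
    show "AE s in lborel. norm (H (s, x)) \<le> norm (indicator {0..t} s * g s * indicator (cbox a b) x)"
      using bound by (auto intro!: AE_I2 order_trans[OF bound])
  qed measurable
  have sec2: "integrable lborel (\<lambda>x. H (s, x))" for s
  proof (rule Bochner_Integration.integrable_bound)
    show "integrable lborel (\<lambda>x. indicator {0..t} s * g s * indicator (cbox a b) x)"
      using cell by (rule integrable_mult_right)
    show "AE x in lborel. norm (H (s, x)) \<le> norm (indicator {0..t} s * g s * indicator (cbox a b) x)"
      using bound by (auto intro!: AE_I2 order_trans[OF bound])
  qed measurable
  have int: "integrable (lborel \<Otimes>\<^sub>M lborel) H"
  proof (rule lborel_pair.Fubini_integrable)
    show "integrable lborel (\<lambda>s. LINT x|lborel. norm (H (s, x)))"
    proof (rule Bochner_Integration.integrable_bound)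
      show "integrable lborel (\<lambda>s. indicator {0..t} s * g s * measure lborel (cbox a b))"
        using g' by (intro integrable_mult_left) (simp add: set_integrable_def)
      have "(LINT x|lborel. norm (H (s, x))) \<le> indicator {0..t} s * g s * measure lborel (cbox a b)" for s
      proof -
        have "(LINT x|lborel. norm (H (s, x)))
            \<le> (LINT x|lborel. indicator {0..t} s * g s * indicator (cbox a b) x)"
          using bound sec2 cell by (intro integral_mono) auto
        then show ?thesis by simp
      qed
      then show "AE s in lborel. norm (LINT x|lborel. norm (H (s, x)))
          \<le> norm (indicator {0..t} s * g s * measure lborel (cbox a b))"
        by (intro AE_I2) (auto intro!: order_trans[OF _ abs_ge_self])
    qed measurable
  qed (use sec2 in auto)
  have set1: "set_integrable lborel {0..t} (\<lambda>s. G s x)" if "x \<in> cbox a b" for x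
    using sec1[of x] that by (simp add: H_def set_integrable_def indicator_times)
  have lint1: "(LINT s|lborel. H (s, x)) = indicator (cbox a b) x * integral {0..t} (\<lambda>s. G s x)" for x
    using set_borel_integral_eq_integral(2)[OF set1, of x]
    by (cases "x \<in> cbox a b") (simp_all add: H_def set_lebesgue_integral_def indicator_times)
  have set2: "set_integrable lborel (cbox a b) (G s)" if "s \<in> {0..t}" for s
    using sec2[of s] that by (simp add: H_def set_integrable_def indicator_times)
  have lint2: "(LINT x|lborel. H (s, x)) = indicator {0..t} s * integral (cbox a b) (G s)" for s
    using set_borel_integral_eq_integral(2)[OF set2, of s]
    by (cases "s \<in> {0..t}") (simp_all add: H_def set_lebesgue_integral_def indicator_times)
  have sint1: "set_integrable lborel (cbox a b) (\<lambda>x. integral {0..t} (\<lambda>s. G s x))"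
    using lborel_pair.integrable_snd[of "\<lambda>s x. H (s, x)"] int
    by (simp add: set_integrable_def lint1)
  have sint2: "set_integrable lborel {0..t} (\<lambda>s. integral (cbox a b) (G s))"
    using lborel_pair.integrable_fst'[OF int]
    by (simp add: set_integrable_def lint2)
  show "\<And>x. x \<in> cbox a b \<Longrightarrow> (\<lambda>s. G s x) integrable_on {0..t}"
    using set1 by (rule set_borel_integral_eq_integral)
  show "(\<lambda>x. integral {0..t} (\<lambda>s. G s x)) integrable_on cbox a b"
    using sint1 by (rule set_borel_integral_eq_integral)
  have "(LINT x|lborel. LINT s|lborel. H (s, x)) = (LINT s|lborel. LINT x|lborel. H (s, x))"
    using lborel_pair.Fubini_integral[of "\<lambda>s x. H (s, x)"] int by simp
  then show "integral (cbox a b) (\<lambda>x. integral {0..t} (\<lambda>s. G s x))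
      = integral {0..t} (\<lambda>s. integral (cbox a b) (G s))"
    unfolding lint1 lint2 set_borel_integral_eq_integral(2)[OF sint1, symmetric]
      set_borel_integral_eq_integral(2)[OF sint2, symmetric]
    by (simp add: set_lebesgue_integral_def)
qed

text \<open>A path of smooth periodic fields all of whose spatial derivatives are dominated in time. The
  paths of the velocity components are of this kind because they are jointly continuous, those of the
  drift because they are integrable in time uniformly in space; sums of such paths are again such
  paths.\<close>

definition dominated_path :: "real \<Rightarrow> 'a \<Rightarrow> 'a \<Rightarrow> (real \<Rightarrow> 'a::euclidean_space \<Rightarrow> real) \<Rightarrow> bool" where
  "dominated_path T a b f \<longleftrightarrow>
     (\<forall>t\<in>{0..T}. smooth_periodic a b (f t)) \<and>
     (\<forall>is\<in>lists Basis. time_dominated T a b (\<lambda>t x. pdvs is (f t) x))"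

lemma dominated_pathD:
  "dominated_path T a b f \<Longrightarrow> is \<in> lists Basis \<Longrightarrow> time_dominated T a b (\<lambda>t x. pdvs is (f t) x)"
  by (simp add: dominated_path_def)

lemma dominated_path_add:
  assumes f: "dominated_path T a b f" and g: "dominated_path T a b g"
  shows "dominated_path T a b (\<lambda>t x. f t x + g t x)"
  unfolding dominated_path_def
proof (intro conjI ballI)
  show "smooth_periodic a b (\<lambda>x. f t x + g t x)" if "t \<in> {0..T}" for t
    using f g that by (auto simp: dominated_path_def intro: smooth_periodic_add)
  fix "is" :: "'a list" assume "is": "is \<in> lists Basis"
  have "time_dominated T a b (\<lambda>t x. pdvs is (f t) x + pdvs is (g t) x)"
    using f g "is" by (auto simp: dominated_path_def intro: time_dominated_add)
  moreover have "pdvs is (\<lambda>x. f t x + g t x) x = pdvs is (f t) x + pdvs is (g t) x"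
    if "t \<in> {0..T}" for t x
    using f g "is" that by (subst pdvs_add) (auto simp: dominated_path_def smooth_periodic_def)
  ultimately show "time_dominated T a b (\<lambda>t x. pdvs is (\<lambda>x. f t x + g t x) x)"
    by (subst time_dominated_cong)
qed

lemma cont_smooth_field_dominated_path:
  fixes f :: "('w, 'a::euclidean_space, real) field"
  assumes "cont_smooth_field M T a b f"
  shows "AE \<omega> in M. dominated_path T a b (f \<omega>)"
  using assms unfolding cont_smooth_field_def
  by (rule eventually_mono) (auto simp: dominated_path_def intro: time_dominated_continuous)

lemma time_integrable_field_dominated_path:
  assumes f: "time_integrable_field M T a b f" and L: "bounded_linear L"
  shows "AE \<omega> in M. dominated_path T a b (\<lambda>t x. L (f \<omega> t x) :: real)"
  using f unfolding time_integrable_field_def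
proof (rule eventually_mono, elim conjE)
  fix \<omega>
  assume smooth: "\<forall>t\<in>{0..T}. smooth_periodic a b (f \<omega> t)"
    and dom: "\<forall>is\<in>lists Basis.
           (\<lambda>(t, x). pdvs is (f \<omega> t) x) \<in> borel_measurable (restrict_space borel ({0..T} \<times> UNIV)) \<and>
           (\<exists>g. set_integrable lborel {0..T} g \<and>
             (\<forall>t\<in>{0..T}. \<forall>x. norm (pdvs is (f \<omega> t) x) \<le> g t))"
  obtain K where K: "0 \<le> K" "\<And>y. norm (L y) \<le> norm y * K"
    using bounded_linear.nonneg_bounded[OF L] by blast
  have "time_dominated T a b (\<lambda>t x. pdvs is (\<lambda>y. L (f \<omega> t y)) x)" if "is": "is \<in> lists Basis" for "is"
  proof -
    obtain g where g: "set_integrable lborel {0..T} g"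
      "\<And>t x. t \<in> {0..T} \<Longrightarrow> norm (pdvs is (f \<omega> t) x) \<le> g t"
      using bspec[OF dom "is"] by blast
    have "L \<in> borel_measurable borel"
      using linear_continuous_on[OF L] by (rule borel_measurable_continuous_onI)
    then have "(\<lambda>(t, x). L (pdvs is (f \<omega> t) x)) \<in> borel_measurable (restrict_space borel ({0..T} \<times> UNIV))"
      using bspec[OF dom "is"] unfolding case_prod_unfold by (auto intro: measurable_compose)
    moreover have "\<bar>L (pdvs is (f \<omega> t) x)\<bar> \<le> g t * K" if "t \<in> {0..T}" for t x
      using order_trans[OF K(2) mult_right_mono[OF g(2)[OF that] K(1)]] by simp
    moreover have "set_integrable lborel {0..T} (\<lambda>t. g t * K)"
      using g(1) by simp
    ultimately have "time_dominated T a b (\<lambda>t x. L (pdvs is (f \<omega> t) x))"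
      unfolding time_dominated_def by blast
    moreover have "pdvs is (\<lambda>y. L (f \<omega> t y)) x = L (pdvs is (f \<omega> t) x)" if "t \<in> {0..T}" for t x
      using smooth "is" that by (subst pdvs_bounded_linear[OF L]) (auto simp: smooth_periodic_def)
    ultimately show ?thesis
      by (subst time_dominated_cong)
  qed
  moreover have "\<forall>t\<in>{0..T}. smooth_periodic a b (\<lambda>x. L (f \<omega> t x))"
    using smooth by (auto intro: smooth_periodic_bounded_linear[OF L])
  ultimately show "dominated_path T a b (\<lambda>t x. L (f \<omega> t x))"
    by (simp add: dominated_path_def)
qed

lemma smooth_semimartingale_cont_smooth_field:
  assumes "smooth_semimartingale M F T a b f"
  shows "cont_smooth_field M T a b f"
proof -
  from assms obtain m v where f: "\<And>\<omega> t x. \<omega> \<in> space M \<Longrightarrow> t \<in> {0..T} \<Longrightarrow> f \<omega> t x = m \<omega> t x + v \<omega> t x"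
    and m: "cont_smooth_field M T a b m" and v: "cont_smooth_field M T a b v"
    unfolding smooth_semimartingale_def by blast
  show ?thesis
    unfolding cont_smooth_field_def
    using m[unfolded cont_smooth_field_def] v[unfolded cont_smooth_field_def] AE_space
  proof eventually_elim
    case (elim \<omega>)
    have eq: "f \<omega> t = (\<lambda>x. m \<omega> t x + v \<omega> t x)" if "t \<in> {0..T}" for t
      using f[OF elim(3) that] by auto
    show ?case
    proof (intro conjI ballI)
      show "smooth_periodic a b (f \<omega> t)" if "t \<in> {0..T}" for t
        using elim that by (auto simp: eq intro: smooth_periodic_add)
      fix "is" :: "'b list" assume "is": "is \<in> lists Basis"
      have "continuous_on ({0..T} \<times> UNIV) (\<lambda>(t, x). pdvs is (m \<omega> t) x + pdvs is (v \<omega> t) x)"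
        using elim(1,2) "is" unfolding case_prod_unfold by (intro continuous_intros) auto
      moreover have "pdvs is (f \<omega> t) x = pdvs is (m \<omega> t) x + pdvs is (v \<omega> t) x"
        if "t \<in> {0..T}" for t x
        using elim "is" that by (simp add: eq pdvs_add smooth_periodic_def)
      ultimately show "continuous_on ({0..T} \<times> UNIV) (\<lambda>(t, x). pdvs is (f \<omega> t) x)"
        by (subst continuous_on_cong[OF refl]) auto
    qed
  qed
qed

section \<open>Stratonovich integrals with integrands of zero mean\<close>

text \<open>No measurability of \<open>X\<close> is needed: for \<open>e = 2^-k\<close> the exceptional events have summable
  probabilities, and the Borel-Cantelli lemma applies to them.\<close>

lemma (in prob_space) AE_zero_if_small_in_prob:
  fixes X :: "'a \<Rightarrow> real"
  assumes "\<And>e. 0 < e \<Longrightarrow> \<exists>A\<in>sets M. measure M A < e \<and> (AE \<omega> in M. \<omega> \<notin> A \<longrightarrow> \<bar>X \<omega>\<bar> \<le> C * e)"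
  shows "AE \<omega> in M. X \<omega> = 0"
proof -
  have "\<exists>A. A \<in> sets M \<and> measure M A < (1/2) ^ k \<and>
      (AE \<omega> in M. \<omega> \<notin> A \<longrightarrow> \<bar>X \<omega>\<bar> \<le> C * (1/2) ^ k)" for k
    using assms[of "(1/2) ^ k"] by (auto simp: Bex_def)
  then have "\<exists>A. \<forall>k. A k \<in> sets M \<and> measure M (A k) < (1/2) ^ k \<and>
      (AE \<omega> in M. \<omega> \<notin> A k \<longrightarrow> \<bar>X \<omega>\<bar> \<le> C * (1/2) ^ k)"
    by (intro choice allI)
  then obtain A where A: "\<And>k. A k \<in> sets M" "\<And>k. measure M (A k) < (1/2) ^ k"
    "\<And>k. AE \<omega> in M. \<omega> \<notin> A k \<longrightarrow> \<bar>X \<omega>\<bar> \<le> C * (1/2) ^ k"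
    by blast
  have "summable (\<lambda>k. measure M (A k))"
    by (rule summable_comparison_test'[OF summable_geometric[of "1/2 :: real"], of 0])
       (use A(2) less_imp_le in auto)
  then have "AE \<omega> in M. eventually (\<lambda>k. \<omega> \<in> space M - A k) sequentially"
    using A(1) by (intro borel_cantelli_AE1) (auto simp: emeasure_eq_measure)
  moreover have "AE \<omega> in M. \<forall>k. \<omega> \<notin> A k \<longrightarrow> \<bar>X \<omega>\<bar> \<le> C * (1/2) ^ k"
    using A(3) by (simp add: AE_all_countable)
  ultimately show ?thesis
  proof eventually_elim
    case (elim \<omega>)
    then have "eventually (\<lambda>k. \<bar>X \<omega>\<bar> \<le> C * (1/2) ^ k) sequentially"
      by (auto elim: eventually_mono)
    moreover have "(\<lambda>k. C * (1/2 :: real) ^ k) \<longlonglongrightarrow> C * 0"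
      by (intro tendsto_intros) simp
    ultimately have "\<bar>X \<omega>\<bar> \<le> C * 0"
      by (intro tendsto_lowerbound) auto
    then show ?case by simp
  qed
qed

text \<open>Closeness in probability is uniform on the cell, so it passes to the integrals over the cell. The
  two limits have to be treated together, since only the combination has integral zero.\<close>

lemma (in prob_space) integral_zero_limit_in_prob:
  fixes J1 J2 :: "'a \<Rightarrow> 'b::euclidean_space \<Rightarrow> real"
  assumes approx: "\<And>e. 0 < e \<Longrightarrow> \<exists>f g. close_in_prob M a b [] e f J1 \<and> close_in_prob M a b [] e g J2 \<and>
      (AE \<omega> in M. continuous_on (cbox a b) (f \<omega>) \<and> continuous_on (cbox a b) (g \<omega>) \<and>
        integral (cbox a b) (\<lambda>x. c * f \<omega> x + g \<omega> x) = 0)"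
    and J: "AE \<omega> in M. continuous_on (cbox a b) (J1 \<omega>)" "AE \<omega> in M. continuous_on (cbox a b) (J2 \<omega>)"
  shows "AE \<omega> in M. integral (cbox a b) (\<lambda>x. c * J1 \<omega> x + J2 \<omega> x) = 0"
proof (rule AE_zero_if_small_in_prob)
  fix e :: real assume "0 < e"
  then have e: "0 < e / 2" by simp
  from approx[OF this] obtain f g where fg: "close_in_prob M a b [] (e/2) f J1"
      "close_in_prob M a b [] (e/2) g J2"
      "AE \<omega> in M. continuous_on (cbox a b) (f \<omega>) \<and> continuous_on (cbox a b) (g \<omega>) \<and>
        integral (cbox a b) (\<lambda>x. c * f \<omega> x + g \<omega> x) = 0"
    by (elim exE conjE)
  obtain A1 where A1: "A1 \<in> sets M" "measure M A1 < e/2"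
    "\<And>\<omega> x. \<omega> \<in> space M - A1 \<Longrightarrow> x \<in> cbox a b \<Longrightarrow> \<bar>f \<omega> x - J1 \<omega> x\<bar> < e/2"
    using fg(1) unfolding close_in_prob_def by auto
  obtain A2 where A2: "A2 \<in> sets M" "measure M A2 < e/2"
    "\<And>\<omega> x. \<omega> \<in> space M - A2 \<Longrightarrow> x \<in> cbox a b \<Longrightarrow> \<bar>g \<omega> x - J2 \<omega> x\<bar> < e/2"
    using fg(2) unfolding close_in_prob_def by auto
  show "\<exists>A\<in>sets M. measure M A < e \<and> (AE \<omega> in M. \<omega> \<notin> A \<longrightarrow>
      \<bar>integral (cbox a b) (\<lambda>x. c * J1 \<omega> x + J2 \<omega> x)\<bar> \<le> (\<bar>c\<bar> + 1) * measure lborel (cbox a b) * e)"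
  proof (intro bexI conjI)
    show "measure M (A1 \<union> A2) < e"
      using measure_Un_le[OF A1(1) A2(1)] A1(2) A2(2) by linarith
    show "AE \<omega> in M. \<omega> \<notin> A1 \<union> A2 \<longrightarrow>
      \<bar>integral (cbox a b) (\<lambda>x. c * J1 \<omega> x + J2 \<omega> x)\<bar> \<le> (\<bar>c\<bar> + 1) * measure lborel (cbox a b) * e"
      using fg(3) J AE_space
    proof eventually_elim
      case (elim \<omega>)
      show ?case
      proof
        assume \<omega>: "\<omega> \<notin> A1 \<union> A2"
        let ?J = "\<lambda>x. c * J1 \<omega> x + J2 \<omega> x" and ?f = "\<lambda>x. c * f \<omega> x + g \<omega> x"
        have cont: "continuous_on (cbox a b) ?J" "continuous_on (cbox a b) ?f"
          using elim by (auto intro!: continuous_intros)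
        have "norm (?J x - ?f x) \<le> (\<bar>c\<bar> + 1) * e" if "x \<in> cbox a b" for x
        proof -
          have near: "\<bar>f \<omega> x - J1 \<omega> x\<bar> \<le> e" "\<bar>g \<omega> x - J2 \<omega> x\<bar> \<le> e"
            using A1(3)[of \<omega> x] A2(3)[of \<omega> x] \<omega> elim(4) that \<open>0 < e\<close> by auto
          have "\<bar>?J x - ?f x\<bar> = \<bar>c * (f \<omega> x - J1 \<omega> x) + (g \<omega> x - J2 \<omega> x)\<bar>"
            by (simp add: abs_minus_commute algebra_simps)
          also have "\<dots> \<le> \<bar>c\<bar> * \<bar>f \<omega> x - J1 \<omega> x\<bar> + \<bar>g \<omega> x - J2 \<omega> x\<bar>"
            by (rule order_trans[OF abs_triangle_ineq]) (simp add: abs_mult)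
          also have "\<dots> \<le> \<bar>c\<bar> * e + e"
            using near by (intro add_mono mult_left_mono) auto
          finally show ?thesis by (simp add: algebra_simps)
        qed
        then have "norm (integral (cbox a b) (\<lambda>x. ?J x - ?f x)) \<le> (\<bar>c\<bar> + 1) * e * measure lborel (cbox a b)"
          using \<open>0 < e\<close>
          by (intro integrable_bound integrable_continuous continuous_on_diff cont) auto
        moreover have "integral (cbox a b) (\<lambda>x. ?J x - ?f x) = integral (cbox a b) ?J"
          using elim cont by (subst integral_diff) (auto intro: integrable_continuous)
        ultimately show "\<bar>integral (cbox a b) ?J\<bar> \<le> (\<bar>c\<bar> + 1) * measure lborel (cbox a b) * e"
          by (simp add: mult_ac)
      qed
    qed
  qed (use A1 A2 in auto)
qed

lemma cont_smooth_field_continuous_on: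
  assumes "cont_smooth_field M T a b J"
  shows "AE \<omega> in M. continuous_on ({0..T} \<times> UNIV) (\<lambda>(t, x). J \<omega> t x)"
proof -
  have "AE \<omega> in M. \<forall>is\<in>lists Basis. continuous_on ({0..T} \<times> UNIV) (\<lambda>(t, x). pdvs is (J \<omega> t) x)"
    using assms unfolding cont_smooth_field_def by (rule eventually_mono) blast
  then show ?thesis
    by (rule eventually_mono) (drule bspec[OF _ lists.Nil], simp)
qed

lemma cont_smooth_field_continuous_on_cell:
  assumes "cont_smooth_field M T a b J"
    and "t \<in> {0..T}"
  shows "AE \<omega> in M. continuous_on S (J \<omega> t)"
  using assms unfolding cont_smooth_field_def smooth_periodic_def
  by (auto elim!: eventually_mono intro: smooth_continuous)

lemma has_strat_integral_regular: "has_strat_integral M T a b Y X J \<Longrightarrow> cont_smooth_field M T a b J"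
  by (simp add: has_strat_integral_def)

lemma has_noise_integral_regular: "has_noise_integral M T a b I B Y J \<Longrightarrow> cont_smooth_field M T a b J"
  by (simp add: has_noise_integral_def)

lemma has_noise_integral_partial_sums:
  assumes J: "has_noise_integral M T a b I B Y J" and t: "t \<in> {0..T}"
  shows "\<exists>K. (\<forall>n\<in>I. has_strat_integral M T a b (Y n) (\<lambda>\<omega> t x. B n \<omega> t) (K n)) \<and>
    (\<forall>e>0. \<exists>N0. \<forall>N\<ge>N0. close_in_prob M a b [] e
      (\<lambda>\<omega> x. \<Sum>n | n \<in> I \<and> n < N. K n \<omega> t x) (\<lambda>\<omega>. J \<omega> t))"
proof -
  from J obtain K where K: "\<forall>n\<in>I. has_strat_integral M T a b (Y n) (\<lambda>\<omega> t x. B n \<omega> t) (K n)"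
    "\<forall>t\<in>{0..T}. \<forall>is\<in>lists Basis. \<forall>e>0. \<exists>N0. \<forall>N\<ge>N0. close_in_prob M a b is e
      (\<lambda>\<omega> x. \<Sum>n | n \<in> I \<and> n < N. K n \<omega> t x) (\<lambda>\<omega>. J \<omega> t)"
    unfolding has_noise_integral_def by (elim conjE exE)
  show ?thesis
    by (intro exI[of _ K] conjI K(1) bspec[OF bspec[OF K(2) t] lists.Nil])
qed

lemma ex_fine_partition:
  assumes "0 \<le> t" "0 < \<delta>"
  shows "\<exists>N p. partition_on_to t N p \<and> (\<forall>k<N. p (Suc k) - p k < \<delta>) \<and> (\<forall>k\<le>N. p k \<in> {0..t})"
proof -
  obtain N where N: "t / \<delta> < real N" "0 < N"
    by (metis assms divide_nonneg_pos gr0I less_le_not_le of_nat_0 reals_Archimedean2)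
  let ?p = "\<lambda>k. t * real k / real N"
  have "partition_on_to t N ?p"
    using assms N by (auto simp: partition_on_to_def intro!: divide_right_mono mult_left_mono)
  moreover have "?p (Suc k) - ?p k < \<delta>" for k
  proof -
    have "?p (Suc k) - ?p k = t / real N"
      using N by (simp add: field_simps)
    also have "\<dots> < \<delta>"
      using N assms by (simp add: field_simps)
    finally show ?thesis .
  qed
  moreover have "?p k \<in> {0..t}" if "k \<le> N" for k
    using that assms N by (auto simp: divide_le_eq mult_left_mono)
  ultimately show ?thesis by blast
qed

lemma strat_sum_integral_zero:
  fixes Y1 Y2 :: "real \<Rightarrow> 'a::euclidean_space \<Rightarrow> real"
  assumes Y: "\<And>k. k \<le> N \<Longrightarrow> continuous_on (cbox a b) (Y1 (p k))"
      "\<And>k. k \<le> N \<Longrightarrow> continuous_on (cbox a b) (Y2 (p k))"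
      "\<And>k. k \<le> N \<Longrightarrow> integral (cbox a b) (\<lambda>x. c * Y1 (p k) x + Y2 (p k) x) = 0"
  shows "continuous_on (cbox a b) (\<lambda>x. strat_sum N p (\<lambda>s. Y1 s x) X)"
    and "continuous_on (cbox a b) (\<lambda>x. strat_sum N p (\<lambda>s. Y2 s x) X)"
    and "integral (cbox a b) (\<lambda>x. c * strat_sum N p (\<lambda>s. Y1 s x) X + strat_sum N p (\<lambda>s. Y2 s x) X) = 0"
proof -
  show "continuous_on (cbox a b) (\<lambda>x. strat_sum N p (\<lambda>s. Y1 s x) X)"
    "continuous_on (cbox a b) (\<lambda>x. strat_sum N p (\<lambda>s. Y2 s x) X)"
    unfolding strat_sum_def using Y by (auto intro!: continuous_intros)
  let ?Z = "\<lambda>k x. c * Y1 (p k) x + Y2 (p k) x"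
  have int: "?Z k integrable_on cbox a b" if "k \<le> N" for k
    using Y that by (intro integrable_continuous continuous_intros) auto
  have "c * strat_sum N p (\<lambda>s. Y1 s x) X + strat_sum N p (\<lambda>s. Y2 s x) X
      = (\<Sum>k<N. (X (p (Suc k)) - X (p k)) / 2 * (?Z k x + ?Z (Suc k) x))" for x
    unfolding strat_sum_def sum_distrib_left sum.distrib[symmetric]
    by (intro sum.cong) (auto simp: field_simps)
  then have "integral (cbox a b) (\<lambda>x. c * strat_sum N p (\<lambda>s. Y1 s x) X + strat_sum N p (\<lambda>s. Y2 s x) X)
      = (\<Sum>k<N. integral (cbox a b) (\<lambda>x. (X (p (Suc k)) - X (p k)) / 2 * (?Z k x + ?Z (Suc k) x)))"
    using int by (simp only:)
      (rule integral_sum, simp, rule integrable_on_mult_right, rule integrable_add, simp_all only: lessThan_iff Suc_leI less_imp_le)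
  also have "\<dots> = (\<Sum>k<N. (X (p (Suc k)) - X (p k)) / 2 *
      (integral (cbox a b) (?Z k) + integral (cbox a b) (?Z (Suc k))))"
    using int by (intro sum.cong) (simp_all only: integral_mult_right integral_add lessThan_iff Suc_leI less_imp_le)
  also have "\<dots> = 0"
    using Y by simp
  finally show "integral (cbox a b)
      (\<lambda>x. c * strat_sum N p (\<lambda>s. Y1 s x) X + strat_sum N p (\<lambda>s. Y2 s x) X) = 0" .
qed

lemma (in prob_space) strat_integral_zero_mean:
  assumes J1: "has_strat_integral M T a b Y1 (\<lambda>\<omega> t x. W \<omega> t) J1"
    and J2: "has_strat_integral M T a b Y2 (\<lambda>\<omega> t x. W \<omega> t) J2"
    and Y: "AE \<omega> in M. \<forall>s\<in>{0..T}. continuous_on (cbox a b) (Y1 \<omega> s) \<and> continuous_on (cbox a b) (Y2 \<omega> s) \<and>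
      integral (cbox a b) (\<lambda>x. c * Y1 \<omega> s x + Y2 \<omega> s x) = 0"
    and t: "t \<in> {0..T}"
  shows "AE \<omega> in M. integral (cbox a b) (\<lambda>x. c * J1 \<omega> t x + J2 \<omega> t x) = 0"
proof (rule integral_zero_limit_in_prob)
  fix e :: real assume e: "0 < e"
  have conv: "\<exists>\<delta>>0. \<forall>N p. partition_on_to t N p \<and> (\<forall>k<N. p (Suc k) - p k < \<delta>) \<longrightarrow>
      close_in_prob M a b [] e (\<lambda>\<omega> x. strat_sum N p (\<lambda>s. Y \<omega> s x) (W \<omega>)) (\<lambda>\<omega>. J \<omega> t)"
    if "has_strat_integral M T a b Y (\<lambda>\<omega> t x. W \<omega> t) J" for Y J
    using that t e lists.Nil unfolding has_strat_integral_def by blast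
  obtain \<delta>1 where \<delta>1: "0 < \<delta>1" "\<And>N p. partition_on_to t N p \<Longrightarrow> \<forall>k<N. p (Suc k) - p k < \<delta>1 \<Longrightarrow>
      close_in_prob M a b [] e (\<lambda>\<omega> x. strat_sum N p (\<lambda>s. Y1 \<omega> s x) (W \<omega>)) (\<lambda>\<omega>. J1 \<omega> t)"
    using conv[OF J1] by blast
  obtain \<delta>2 where \<delta>2: "0 < \<delta>2" "\<And>N p. partition_on_to t N p \<Longrightarrow> \<forall>k<N. p (Suc k) - p k < \<delta>2 \<Longrightarrow>
      close_in_prob M a b [] e (\<lambda>\<omega> x. strat_sum N p (\<lambda>s. Y2 \<omega> s x) (W \<omega>)) (\<lambda>\<omega>. J2 \<omega> t)"
    using conv[OF J2] by blast
  obtain N p where p: "partition_on_to t N p" "\<forall>k<N. p (Suc k) - p k < min \<delta>1 \<delta>2"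
    "\<And>k. k \<le> N \<Longrightarrow> p k \<in> {0..t}"
    using ex_fine_partition[of t "min \<delta>1 \<delta>2"] t \<delta>1(1) \<delta>2(1) by auto
  have "AE \<omega> in M. continuous_on (cbox a b) (\<lambda>x. strat_sum N p (\<lambda>s. Y1 \<omega> s x) (W \<omega>)) \<and>
      continuous_on (cbox a b) (\<lambda>x. strat_sum N p (\<lambda>s. Y2 \<omega> s x) (W \<omega>)) \<and>
      integral (cbox a b) (\<lambda>x. c * strat_sum N p (\<lambda>s. Y1 \<omega> s x) (W \<omega>)
        + strat_sum N p (\<lambda>s. Y2 \<omega> s x) (W \<omega>)) = 0"
    using Y
  proof eventually_elim
    case (elim \<omega>)
    then have "continuous_on (cbox a b) (Y1 \<omega> (p k))" "continuous_on (cbox a b) (Y2 \<omega> (p k))"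
      "integral (cbox a b) (\<lambda>x. c * Y1 \<omega> (p k) x + Y2 \<omega> (p k) x) = 0" if "k \<le> N" for k
      using p(3)[OF that] t by auto
    from strat_sum_integral_zero[of N a b "Y1 \<omega>" p "Y2 \<omega>" c, OF this] show ?case by blast
  qed
  moreover have "close_in_prob M a b [] e (\<lambda>\<omega> x. strat_sum N p (\<lambda>s. Y1 \<omega> s x) (W \<omega>)) (\<lambda>\<omega>. J1 \<omega> t)"
    "close_in_prob M a b [] e (\<lambda>\<omega> x. strat_sum N p (\<lambda>s. Y2 \<omega> s x) (W \<omega>)) (\<lambda>\<omega>. J2 \<omega> t)"
    using p \<delta>1(2) \<delta>2(2) by auto
  ultimately show "\<exists>f g. close_in_prob M a b [] e f (\<lambda>\<omega>. J1 \<omega> t) \<and> close_in_prob M a b [] e g (\<lambda>\<omega>. J2 \<omega> t) \<and>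
      (AE \<omega> in M. continuous_on (cbox a b) (f \<omega>) \<and> continuous_on (cbox a b) (g \<omega>) \<and>
        integral (cbox a b) (\<lambda>x. c * f \<omega> x + g \<omega> x) = 0)"
    by blast
next
  show "AE \<omega> in M. continuous_on (cbox a b) (J1 \<omega> t)" "AE \<omega> in M. continuous_on (cbox a b) (J2 \<omega> t)"
    using t by (auto intro!: cont_smooth_field_continuous_on_cell
        has_strat_integral_regular[OF J1] has_strat_integral_regular[OF J2])
qed

text \<open>Each partial sum of the two series has zero mean by the lemma above, and the series converge in
  probability.\<close>

lemma (in prob_space) noise_integral_zero_mean_at:
  assumes J1: "has_noise_integral M T a b I B Y1 J1"
    and J2: "has_noise_integral M T a b I B Y2 J2"
    and Y: "\<And>n. n \<in> I \<Longrightarrow> AE \<omega> in M. \<forall>s\<in>{0..T}.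
      continuous_on (cbox a b) (Y1 n \<omega> s) \<and> continuous_on (cbox a b) (Y2 n \<omega> s) \<and>
      integral (cbox a b) (\<lambda>x. c * Y1 n \<omega> s x + Y2 n \<omega> s x) = 0"
    and t: "t \<in> {0..T}"
  shows "AE \<omega> in M. integral (cbox a b) (\<lambda>x. c * J1 \<omega> t x + J2 \<omega> t x) = 0"
proof (rule integral_zero_limit_in_prob)
  obtain K1 where K1: "\<forall>n\<in>I. has_strat_integral M T a b (Y1 n) (\<lambda>\<omega> t x. B n \<omega> t) (K1 n)"
    "\<forall>e>0. \<exists>N0. \<forall>N\<ge>N0. close_in_prob M a b [] e
      (\<lambda>\<omega> x. \<Sum>n | n \<in> I \<and> n < N. K1 n \<omega> t x) (\<lambda>\<omega>. J1 \<omega> t)"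
    using has_noise_integral_partial_sums[OF J1 t] by (elim exE conjE)
  obtain K2 where K2: "\<forall>n\<in>I. has_strat_integral M T a b (Y2 n) (\<lambda>\<omega> t x. B n \<omega> t) (K2 n)"
    "\<forall>e>0. \<exists>N0. \<forall>N\<ge>N0. close_in_prob M a b [] e
      (\<lambda>\<omega> x. \<Sum>n | n \<in> I \<and> n < N. K2 n \<omega> t x) (\<lambda>\<omega>. J2 \<omega> t)"
    using has_noise_integral_partial_sums[OF J2 t] by (elim exE conjE)
  fix e :: real assume e: "0 < e"
  obtain N1 N2 where N12: "\<forall>N\<ge>N1. close_in_prob M a b [] e
      (\<lambda>\<omega> x. \<Sum>n | n \<in> I \<and> n < N. K1 n \<omega> t x) (\<lambda>\<omega>. J1 \<omega> t)"
    "\<forall>N\<ge>N2. close_in_prob M a b [] e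
      (\<lambda>\<omega> x. \<Sum>n | n \<in> I \<and> n < N. K2 n \<omega> t x) (\<lambda>\<omega>. J2 \<omega> t)"
    using K1(2)[rule_format, OF e] K2(2)[rule_format, OF e] by (elim exE)
  define N where "N = max N1 N2"
  have N: "close_in_prob M a b [] e
      (\<lambda>\<omega> x. \<Sum>n | n \<in> I \<and> n < N. K1 n \<omega> t x) (\<lambda>\<omega>. J1 \<omega> t)"
    "close_in_prob M a b [] e
      (\<lambda>\<omega> x. \<Sum>n | n \<in> I \<and> n < N. K2 n \<omega> t x) (\<lambda>\<omega>. J2 \<omega> t)"
    using N12[THEN spec, of N] unfolding N_def by simp_all
  have fin: "finite {n. n \<in> I \<and> n < N}" by simp
  have "AE \<omega> in M. continuous_on (cbox a b) (K1 n \<omega> t) \<and> continuous_on (cbox a b) (K2 n \<omega> t) \<and>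
      integral (cbox a b) (\<lambda>x. c * K1 n \<omega> t x + K2 n \<omega> t x) = 0" if n: "n \<in> {n. n \<in> I \<and> n < N}" for n
  proof -
    from n have "n \<in> I" by simp
    note K = bspec[OF K1(1) this] bspec[OF K2(1) this]
    have "AE \<omega> in M. continuous_on (cbox a b) (K1 n \<omega> t)" "AE \<omega> in M. continuous_on (cbox a b) (K2 n \<omega> t)"
      using t by (auto intro!: cont_smooth_field_continuous_on_cell
          has_strat_integral_regular[OF K(1)] has_strat_integral_regular[OF K(2)])
    then show ?thesis
      using strat_integral_zero_mean[OF K Y[OF \<open>n \<in> I\<close>] t] by (intro AE_conjI)
  qed
  then have "AE \<omega> in M. \<forall>n\<in>{n. n \<in> I \<and> n < N}.
      continuous_on (cbox a b) (K1 n \<omega> t) \<and> continuous_on (cbox a b) (K2 n \<omega> t) \<and>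
      integral (cbox a b) (\<lambda>x. c * K1 n \<omega> t x + K2 n \<omega> t x) = 0"
    by (intro AE_finite_allI[OF fin])
  then have "AE \<omega> in M. continuous_on (cbox a b) (\<lambda>x. \<Sum>n | n \<in> I \<and> n < N. K1 n \<omega> t x) \<and>
      continuous_on (cbox a b) (\<lambda>x. \<Sum>n | n \<in> I \<and> n < N. K2 n \<omega> t x) \<and>
      integral (cbox a b) (\<lambda>x. c * (\<Sum>n | n \<in> I \<and> n < N. K1 n \<omega> t x)
        + (\<Sum>n | n \<in> I \<and> n < N. K2 n \<omega> t x)) = 0"
  proof eventually_elim
    case (elim \<omega>)
    have "integral (cbox a b) (\<lambda>x. c * (\<Sum>n | n \<in> I \<and> n < N. K1 n \<omega> t x)
        + (\<Sum>n | n \<in> I \<and> n < N. K2 n \<omega> t x))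
      = integral (cbox a b) (\<lambda>x. \<Sum>n | n \<in> I \<and> n < N. c * K1 n \<omega> t x + K2 n \<omega> t x)"
      by (simp add: sum_distrib_left sum.distrib)
    also have "\<dots> = (\<Sum>n | n \<in> I \<and> n < N. integral (cbox a b) (\<lambda>x. c * K1 n \<omega> t x + K2 n \<omega> t x))"
      using elim by (intro integral_sum[OF fin] integrable_continuous continuous_intros) auto
    also have "\<dots> = 0"
      using elim by simp
    finally show ?case
      using elim by (auto intro!: continuous_intros)
  qed
  then show "\<exists>f g. close_in_prob M a b [] e f (\<lambda>\<omega>. J1 \<omega> t) \<and> close_in_prob M a b [] e g (\<lambda>\<omega>. J2 \<omega> t) \<and>
      (AE \<omega> in M. continuous_on (cbox a b) (f \<omega>) \<and> continuous_on (cbox a b) (g \<omega>) \<and>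
        integral (cbox a b) (\<lambda>x. c * f \<omega> x + g \<omega> x) = 0)"
    using N by blast
next
  show "AE \<omega> in M. continuous_on (cbox a b) (J1 \<omega> t)" "AE \<omega> in M. continuous_on (cbox a b) (J2 \<omega> t)"
    using t by (auto intro!: cont_smooth_field_continuous_on_cell
        has_noise_integral_regular[OF J1] has_noise_integral_regular[OF J2])
qed

text \<open>The preceding lemma has an exceptional event for each \<open>t\<close>. Rational times give a single one, and
  the continuity in time of the integrals over the cell extends the conclusion to all times.\<close>

lemma (in prob_space) noise_integral_zero_mean:
  assumes T: "0 < T"
    and J1: "has_noise_integral M T a b I B Y1 J1"
    and J2: "has_noise_integral M T a b I B Y2 J2"
    and Y: "\<And>n. n \<in> I \<Longrightarrow> AE \<omega> in M. \<forall>s\<in>{0..T}.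
      continuous_on (cbox a b) (Y1 n \<omega> s) \<and> continuous_on (cbox a b) (Y2 n \<omega> s) \<and>
      integral (cbox a b) (\<lambda>x. c * Y1 n \<omega> s x + Y2 n \<omega> s x) = 0"
  shows "AE \<omega> in M. \<forall>t\<in>{0..T}. integral (cbox a b) (\<lambda>x. c * J1 \<omega> t x + J2 \<omega> t x) = 0"
proof -
  let ?Q = "{0<..<T} \<inter> \<rat>"
  have Q: "closure ?Q = {0..T}"
    using T closure_open_Int_superset[of "{0<..<T}" "\<rat>"] by (simp add: Rats_closure_real)
  have "countable ?Q"
    using countable_rat by (auto intro: countable_subset)
  then have "AE \<omega> in M. \<forall>t\<in>?Q. integral (cbox a b) (\<lambda>x. c * J1 \<omega> t x + J2 \<omega> t x) = 0"
    using noise_integral_zero_mean_at[OF J1 J2 Y] by (auto simp: AE_ball_countable)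
  moreover have "AE \<omega> in M. continuous_on ({0..T} \<times> UNIV) (\<lambda>(t, x). J1 \<omega> t x)"
    "AE \<omega> in M. continuous_on ({0..T} \<times> UNIV) (\<lambda>(t, x). J2 \<omega> t x)"
    using J1 J2 by (auto simp: has_noise_integral_def intro: cont_smooth_field_continuous_on)
  ultimately show ?thesis
  proof eventually_elim
    case (elim \<omega>)
    have "continuous_on ({0..T} \<times> cbox a b) (\<lambda>(t, x). c * J1 \<omega> t x + J2 \<omega> t x)"
      using elim(2,3) unfolding case_prod_unfold
      by (intro continuous_intros) (auto elim: continuous_on_subset)
    then have "continuous_on (closure ?Q) (\<lambda>t. integral (cbox a b) (\<lambda>x. c * J1 \<omega> t x + J2 \<omega> t x))"
      unfolding Q by (rule integral_continuous_on_param)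
    then show ?case
      using continuous_constant_on_closure[of ?Q _ 0] elim(1) unfolding Q by blast
  qed
qed

section \<open>Conservation of elevation and mass\<close>

text \<open>The pathwise core of the argument: \<open>J1\<close> and \<open>J2\<close> are the values at time \<open>t\<close> of the noise
  integrals in the mass equation, \<open>v\<close> is the transport velocity and \<open>c\<close> the amplitude of the
  noise.\<close>

lemma elevation_integral_constant:
  fixes \<eta> :: "real \<Rightarrow> 'a::euclidean_space \<Rightarrow> real"
  assumes \<eta>: "\<forall>t\<in>{0..T}. smooth_periodic a b (\<eta> t)"
      "\<forall>is\<in>lists Basis. continuous_on ({0..T} \<times> UNIV) (\<lambda>(t, x). pdvs is (\<eta> t) x)"
    and v: "\<forall>i\<in>Basis. dominated_path T a b (\<lambda>t x. v t x \<bullet> i)"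
    and cell: "box a b \<noteq> {}"
    and J: "continuous_on (cbox a b) J1" "continuous_on (cbox a b) J2"
      "integral (cbox a b) (\<lambda>x. \<epsilon> * J1 x + J2 x) = 0"
    and t: "t \<in> {0..T}"
    and eq: "\<And>x. x \<in> cbox a b \<Longrightarrow>
      \<eta> t x - \<eta> 0 x + \<epsilon> * integral {0..t} (\<lambda>s. v s x \<bullet> grad (\<eta> s) x) + c * \<epsilon> * J1 x
      = - (integral {0..t} (\<lambda>s. (1 + \<epsilon> * \<eta> s x) * diverg (v s) x) + c * J2 x)"
  shows "integral (cbox a b) (\<eta> t) = integral (cbox a b) (\<eta> 0)"
proof -
  have \<eta>0: "continuous_on ({0..T} \<times> UNIV) (\<lambda>(t, x). \<eta> t x)"
    using bspec[OF \<eta>(2) lists.Nil] by simp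
  have \<eta>1: "continuous_on ({0..T} \<times> UNIV) (\<lambda>(t, x). pdv i (\<eta> t) x)" if "i \<in> Basis" for i
    using bspec[OF \<eta>(2), of "[i]"] that by simp
  have v0: "time_dominated T a b (\<lambda>t x. v t x \<bullet> i)" if "i \<in> Basis" for i
    using dominated_pathD[OF bspec[OF v that], of "[]"] by simp
  have v1: "time_dominated T a b (\<lambda>t x. pdv i (\<lambda>y. v t y \<bullet> i) x)" if "i \<in> Basis" for i
    using dominated_pathD[OF bspec[OF v that], of "[i]"] that by simp
  let ?A = "\<lambda>s x. v s x \<bullet> grad (\<eta> s) x" and ?D = "\<lambda>s x. (1 + \<epsilon> * \<eta> s x) * diverg (v s) x"
  have A: "time_dominated T a b ?A"
    unfolding inner_grad
    by (intro time_dominated_sum finite_Basis, subst mult.commute) (intro time_dominated_mult \<eta>1 v0)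
  have h: "continuous_on ({0..T} \<times> UNIV) (\<lambda>(t, x). 1 + \<epsilon> * \<eta> t x)"
    using \<eta>0 unfolding case_prod_unfold by (intro continuous_on_add continuous_on_mult continuous_on_const)
  have D: "time_dominated T a b ?D"
    unfolding diverg_def by (intro time_dominated_mult h time_dominated_sum finite_Basis v1)
  have const: "continuous_on ({0..T} \<times> UNIV) (\<lambda>(t, x :: 'a). \<epsilon>)"
    by (simp add: case_prod_unfold)
  have AD: "time_dominated T a b (\<lambda>s x. \<epsilon> * ?A s x + ?D s x)"
    by (intro time_dominated_add D time_dominated_mult[OF const A])
  have zero: "integral (cbox a b) (\<lambda>x. \<epsilon> * ?A s x + ?D s x) = 0" if "s \<in> {0..T}" for s
    using \<eta>(1) v that cell by (intro integral_depth_flux_periodic) (auto simp: dominated_path_def)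
  let ?I = "\<lambda>x. integral {0..t} (\<lambda>s. \<epsilon> * ?A s x + ?D s x)"
  have "integral (cbox a b) ?I = integral {0..t} (\<lambda>s. integral (cbox a b) (\<lambda>x. \<epsilon> * ?A s x + ?D s x))"
    by (rule time_dominated_Fubini(3)[OF AD t])
  also have "\<dots> = integral {0..t} (\<lambda>s. 0)"
    using t by (intro integral_cong zero) auto
  finally have I: "integral (cbox a b) ?I = 0"
    by simp
  have Iint: "?I integrable_on cbox a b"
    by (rule time_dominated_Fubini(2)[OF AD t])
  have J_int: "(\<lambda>x. \<epsilon> * J1 x + J2 x) integrable_on cbox a b"
    by (intro integrable_continuous continuous_intros J)
  have "\<eta> t x - \<eta> 0 x = - (?I x + c * (\<epsilon> * J1 x + J2 x))" if x: "x \<in> cbox a b" for x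
  proof -
    have "?I x = \<epsilon> * integral {0..t} (\<lambda>s. ?A s x) + integral {0..t} (\<lambda>s. ?D s x)"
      using time_dominated_Fubini(1)[OF A t x] time_dominated_Fubini(1)[OF D t x]
      by (subst integral_add) (auto intro: integrable_on_mult_right)
    then show ?thesis
      using eq[OF x] by (simp add: algebra_simps)
  qed
  then have "integral (cbox a b) (\<lambda>x. \<eta> t x - \<eta> 0 x)
      = integral (cbox a b) (\<lambda>x. - (?I x + c * (\<epsilon> * J1 x + J2 x)))"
    by (intro integral_cong)
  also have "\<dots> = - (integral (cbox a b) ?I + c * integral (cbox a b) (\<lambda>x. \<epsilon> * J1 x + J2 x))"
    using Iint J_int by (simp only: integral_neg integral_add integrable_on_mult_right integral_mult_right)
  also have "\<dots> = 0"
    by (simp add: I J(3))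
  finally have "integral (cbox a b) (\<lambda>x. \<eta> t x - \<eta> 0 x) = 0" .
  moreover have "\<eta> s integrable_on cbox a b" if "s \<in> {0..T}" for s
    using \<eta>(1) that by (intro integrable_continuous smooth_continuous) (auto simp: smooth_periodic_def)
  ultimately show ?thesis
    using t by (simp add: integral_diff)
qed

context lu_waves
begin

lemma elevation_conserved:
  assumes \<eta>: "smooth_semimartingale M F T a b \<eta>"
    and u: "\<And>i. i \<in> Basis \<Longrightarrow> smooth_semimartingale M F T a b (\<lambda>\<omega> t x. u \<omega> t x \<bullet> i)"
    and mass: "mass_equation \<eta> u"
  shows "AE \<omega> in M. \<forall>t\<in>{0..T}. total_elevation \<eta> \<omega> t = total_elevation \<eta> \<omega> 0"
proof -
  obtain J1 J2 where J1: "has_noise_integral M T a b I B (\<lambda>n \<omega> t x. \<phi> n \<omega> t x \<bullet> grad (\<eta> \<omega> t) x) J1"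
    and J2: "has_noise_integral M T a b I B (\<lambda>n \<omega> t x. depth \<eta> \<omega> t x * diverg (\<phi> n \<omega> t) x) J2"
    and eq: "AE \<omega> in M. \<forall>t\<in>{0..T}. \<forall>x\<in>cbox a b.
      \<eta> \<omega> t x - \<eta> \<omega> 0 x + \<epsilon> * integral {0..t} (\<lambda>s. ustar u \<omega> s x \<bullet> grad (\<eta> \<omega> s) x)
        + sqrt \<Upsilon> * \<epsilon> * J1 \<omega> t x
      = - (integral {0..t} (\<lambda>s. depth \<eta> \<omega> s x * diverg (ustar u \<omega> s) x) + sqrt \<Upsilon> * J2 \<omega> t x)"
  proof -
    obtain Z D where Z: "has_material u \<eta> Z" and D: "has_div_transport u (depth \<eta>) D"
      and ZD: "AE \<omega> in M. \<forall>t\<in>{0..T}. \<forall>x\<in>cbox a b. Z \<omega> t x = - D \<omega> t x"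
      using mass unfolding mass_equation_def by (elim exE conjE)
    obtain J1 where J1: "has_noise_integral M T a b I B (\<lambda>n \<omega> t x. \<phi> n \<omega> t x \<bullet> grad (\<eta> \<omega> t) x) J1"
      and Z': "AE \<omega> in M. \<forall>t\<in>{0..T}. \<forall>x. Z \<omega> t x = \<eta> \<omega> t x - \<eta> \<omega> 0 x
          + \<epsilon> * integral {0..t} (\<lambda>s. ustar u \<omega> s x \<bullet> grad (\<eta> \<omega> s) x) + sqrt \<Upsilon> * \<epsilon> * J1 \<omega> t x"
      using Z unfolding has_material_def by (elim exE conjE)
    obtain J2 where J2: "has_noise_integral M T a b I B (\<lambda>n \<omega> t x. depth \<eta> \<omega> t x * diverg (\<phi> n \<omega> t) x) J2"
      and D': "AE \<omega> in M. \<forall>t\<in>{0..T}. \<forall>x. D \<omega> t x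
        = integral {0..t} (\<lambda>s. depth \<eta> \<omega> s x * diverg (ustar u \<omega> s) x) + sqrt \<Upsilon> * J2 \<omega> t x"
      using D unfolding has_div_transport_def by (elim exE conjE)
    from ZD Z' D' show thesis
      by (intro that[OF J1 J2], eventually_elim) simp
  qed
  note \<eta>_field = smooth_semimartingale_cont_smooth_field[OF \<eta>]
  have "AE \<omega> in M. \<forall>s\<in>{0..T}. continuous_on (cbox a b) (\<lambda>x. \<phi> n \<omega> s x \<bullet> grad (\<eta> \<omega> s) x) \<and>
      continuous_on (cbox a b) (\<lambda>x. depth \<eta> \<omega> s x * diverg (\<phi> n \<omega> s) x) \<and>
      integral (cbox a b) (\<lambda>x. \<epsilon> * (\<phi> n \<omega> s x \<bullet> grad (\<eta> \<omega> s) x)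
        + depth \<eta> \<omega> s x * diverg (\<phi> n \<omega> s) x) = 0" if "n \<in> I" for n
    using noise_smooth[OF that] \<eta>_field[unfolded cont_smooth_field_def]
  proof eventually_elim
    case (elim \<omega>)
    show ?case
    proof
      fix s assume s: "s \<in> {0..T}"
      have \<eta>_s: "smooth_periodic a b (\<eta> \<omega> s)"
        using elim s by auto
      have \<phi>_s: "smooth_periodic a b (\<lambda>x. \<phi> n \<omega> s x \<bullet> i)" for i
        using elim s by (auto intro: smooth_periodic_bounded_linear[OF bounded_linear_inner_left])
      have smooth: "smooth (\<eta> \<omega> s)" "\<And>i. smooth (\<lambda>x. \<phi> n \<omega> s x \<bullet> i)"
        using \<eta>_s \<phi>_s by (auto simp: smooth_periodic_def)
      show "continuous_on (cbox a b) (\<lambda>x. \<phi> n \<omega> s x \<bullet> grad (\<eta> \<omega> s) x) \<and>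
        continuous_on (cbox a b) (\<lambda>x. depth \<eta> \<omega> s x * diverg (\<phi> n \<omega> s) x) \<and>
        integral (cbox a b) (\<lambda>x. \<epsilon> * (\<phi> n \<omega> s x \<bullet> grad (\<eta> \<omega> s) x)
          + depth \<eta> \<omega> s x * diverg (\<phi> n \<omega> s) x) = 0"
        unfolding depth_def
        by (intro conjI continuous_on_advection continuous_intros continuous_on_diverg
            smooth_continuous smooth integral_depth_flux_periodic \<eta>_s \<phi>_s cell)
    qed
  qed
  then have J: "AE \<omega> in M. \<forall>t\<in>{0..T}. integral (cbox a b) (\<lambda>x. \<epsilon> * J1 \<omega> t x + J2 \<omega> t x) = 0"
    by (rule noise_integral_zero_mean[OF time_horizon J1 J2])
  have "AE \<omega> in M. dominated_path T a b (\<lambda>t x. ustar u \<omega> t x \<bullet> i)" if i: "i \<in> Basis" for i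
  proof -
    \<comment> \<open>The drift enters through a linear functional of it, so that its component has a dominated path.\<close>
    have "bounded_linear (\<lambda>y :: 'a. - (1 / 2 * \<Upsilon> * \<epsilon>) * (y \<bullet> i))"
      by (intro bounded_linear_const_mult bounded_linear_inner_left)
    from time_integrable_field_dominated_path[OF drift_regular this]
      cont_smooth_field_dominated_path[OF smooth_semimartingale_cont_smooth_field[OF u[OF i]]]
    show ?thesis
    proof eventually_elim
      case (elim \<omega>)
      then have "dominated_path T a b (\<lambda>t x. u \<omega> t x \<bullet> i + - (1 / 2 * \<Upsilon> * \<epsilon>) * (us \<omega> t x \<bullet> i))"
        by (intro dominated_path_add)
      then show ?case
        by (simp add: ustar_def inner_diff_left)
    qed
  qed
  then have v: "AE \<omega> in M. \<forall>i\<in>Basis. dominated_path T a b (\<lambda>t x. ustar u \<omega> t x \<bullet> i)"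
    by (intro AE_finite_allI) auto
  show ?thesis
    using eq J v \<eta>_field[unfolded cont_smooth_field_def]
      has_noise_integral_regular[OF J1, unfolded cont_smooth_field_def]
      has_noise_integral_regular[OF J2, unfolded cont_smooth_field_def]
  proof eventually_elim
    case (elim \<omega>)
    show ?case
    proof
      fix t assume t: "t \<in> {0..T}"
      have "smooth (J1 \<omega> t)" "smooth (J2 \<omega> t)"
        using elim(5,6) t by (auto simp: smooth_periodic_def)
      note J_cont = this[THEN smooth_continuous]
      show "total_elevation \<eta> \<omega> t = total_elevation \<eta> \<omega> 0"
        unfolding total_elevation_def
        using elim(1)[unfolded depth_def] elim(2,4) t
        by (intro elevation_integral_constant[OF _ _ elim(3) cell J_cont _ t, where c = "sqrt \<Upsilon>"]) auto
    qed
  qed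
qed

lemma total_mass_eq:
  assumes "cont_smooth_field M T a b \<eta>"
  shows "AE \<omega> in M. \<forall>t\<in>{0..T}.
    total_mass \<rho> \<eta> \<omega> t = \<rho> * (measure lborel (cbox a b) + \<epsilon> * total_elevation \<eta> \<omega> t)"
  using assms unfolding cont_smooth_field_def
proof (rule eventually_mono, intro ballI, elim conjE)
  fix \<omega> t assume "\<forall>t\<in>{0..T}. smooth_periodic a b (\<eta> \<omega> t)" "t \<in> {0..T}"
  then have int: "\<eta> \<omega> t integrable_on cbox a b"
    by (intro integrable_continuous smooth_continuous) (auto simp: smooth_periodic_def)
  have "integral (cbox a b) (\<lambda>x. 1 + \<epsilon> * \<eta> \<omega> t x)
      = integral (cbox a b) (\<lambda>x. 1) + integral (cbox a b) (\<lambda>x. \<epsilon> * \<eta> \<omega> t x)"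
    by (intro integral_add integrable_on_mult_right int) auto
  moreover have "depth \<eta> \<omega> t = (\<lambda>x. 1 + \<epsilon> * \<eta> \<omega> t x)"
    by (simp add: depth_def fun_eq_iff)
  ultimately show "total_mass \<rho> \<eta> \<omega> t = \<rho> * (measure lborel (cbox a b) + \<epsilon> * total_elevation \<eta> \<omega> t)"
    by (simp add: total_mass_def total_elevation_def)
qed

lemma regular_solution_conservation:
  assumes "regular_solution model \<eta> u"
  shows "zero_differential M T (total_elevation \<eta>)" "zero_differential M T (total_mass \<rho> \<eta>)"
proof -
  have \<eta>: "smooth_semimartingale M F T a b \<eta>"
    and u: "\<And>i. i \<in> Basis \<Longrightarrow> smooth_semimartingale M F T a b (\<lambda>\<omega> t x. u \<omega> t x \<bullet> i)"
    and mass: "mass_equation \<eta> u"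
    using assms by (auto simp: regular_solution_def)
  have E: "AE \<omega> in M. \<forall>s\<in>{0..T}. \<forall>t\<in>{s..T}. total_elevation \<eta> \<omega> t = total_elevation \<eta> \<omega> s"
  proof -
    have "AE \<omega> in M. \<forall>t\<in>{0..T}. total_elevation \<eta> \<omega> t = total_elevation \<eta> \<omega> 0"
      by (rule elevation_conserved[OF \<eta> u mass])
    then show ?thesis
    proof eventually_elim
      case (elim \<omega>)
      show ?case
      proof (intro ballI)
        fix s t assume "s \<in> {0..T}" "t \<in> {s..T}"
        then have "s \<in> {0..T}" "t \<in> {0..T}" by auto
        then show "total_elevation \<eta> \<omega> t = total_elevation \<eta> \<omega> s"
          using bspec[OF elim] by metis
      qed
    qed
  qed
  then show "zero_differential M T (total_elevation \<eta>)"
    by (simp add: zero_differential_def)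
  show "zero_differential M T (total_mass \<rho> \<eta>)"
    unfolding zero_differential_def
    using E total_mass_eq[OF smooth_semimartingale_cont_smooth_field[OF \<eta>], of \<rho>]
  proof eventually_elim
    case (elim \<omega>)
    then show ?case
      by (fastforce simp: elim(2))
  qed
qed

end

theorem mainTheorem1:
  fixes M :: "'w measure" and F :: "real \<Rightarrow> 'w measure"
    and a b :: "'a::euclidean_space"
    and T \<epsilon> \<beta> \<Upsilon> \<rho>\<^sub>0 :: real
    and I :: "nat set" and B :: "nat \<Rightarrow> 'w \<Rightarrow> real \<Rightarrow> real"
    and us :: "('w, 'a, 'a) field" and \<phi> :: "nat \<Rightarrow> ('w, 'a, 'a) field"
    and model :: lu_model
    and \<eta> :: "('w, 'a, real) field" and u :: "('w, 'a, 'a) field"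
  assumes "lu_waves M F T a b \<epsilon> \<beta> \<Upsilon> I B us \<phi>"
    and "lu_waves.regular_solution M F T a b \<epsilon> \<beta> \<Upsilon> I B us \<phi> model \<eta> u"
    and "lu_waves.noise_vanishes_on_boundary M T a b I \<phi>"
    and "0 < \<rho>\<^sub>0"
  shows "zero_differential M T (lu_waves.total_elevation a b \<eta>) \<and>
    zero_differential M T (lu_waves.total_mass a b \<epsilon> \<rho>\<^sub>0 \<eta>)"
  using lu_waves.regular_solution_conservation[OF assms(1,2)] by blast

end
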